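(* Let $(\tilde S,\tilde\alpha)$ be a finite cover of a finite area translation surface $(S,\alpha)$ with infinite topological type, with covering map $p:\tilde S\to S$. Suppose that both $(S,\alpha)$ and $(\tilde S,\tilde\alpha)$ have translation flows which are defined for all time almost everywhere and are ergodic. Then Lebesgue measure on $(\tilde S,\tilde\alpha)$ is the unique translation flow-invariant measure on $\tilde S$ which projects to Lebesgue measure on $(S,\alpha)$ under the covering map (i.e. whose push-forward under $p$ is Lebesgue measure on $(S,\alpha)$).
   Context: A translation surface $(S,\alpha)$ is a Riemann surface $S$ (not necessarily compact) with a holomorphic $1$-form $\alpha$. Away from the zeros of $\alpha$, the maps $q\mapsto\int_p^q\alpha$ give charts to $\mathbb C\cong\mathbb R^2$ that differ by translations; area and Lebesgue measure are pulled back from the plane. Lebesgue measures on finite area surfaces are normalized to be probability measures. Infinite topological type means that the fundamental group is not finitely generated. The translation flow is $F^t(x,y)=(x+t,y)$ in these charts; it is defined for all time almost everywhere if for every $t\in\mathbb R$ the map $F^t$ is defined Lebesgue-a.e.; ergodic means ergodic with respect to Lebesgue measure. Covers are unbranched, of finite degree, and carry the pulled-back $1$-form $\tilde\alpha=p^*\alpha$. *)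

theory Defs
  imports "HOL-Analysis.Analysis" "HOL-Algebra.Generated_Groups"
begin

section \<open>Riemann surfaces with a holomorphic 1-form\<close>

text \<open>
  The underlying space of a surface is a whole type, Hausdorff and second countable. A chart
  \<open>(U, \<phi>)\<close> is a homeomorphism \<open>\<phi>\<close> of the open set \<open>U\<close> onto an open subset of the plane; the values
  of \<open>\<phi>\<close> outside \<open>U\<close> are irrelevant.
\<close>

type_synonym 'a chart = "'a set \<times> ('a \<Rightarrow> complex)"

definition is_chart :: "'a::topological_space chart \<Rightarrow> bool" where
  "is_chart c \<longleftrightarrow> (case c of (U, \<phi>) \<Rightarrow>
     open U \<and> open (\<phi> ` U) \<and> (\<exists>g. homeomorphism U (\<phi> ` U) \<phi> g))"

definition in_charts :: "'a chart \<Rightarrow> 'b chart \<Rightarrow> ('a \<Rightarrow> 'b) \<Rightarrow> complex \<Rightarrow> complex" where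
  "in_charts c d f = snd d \<circ> f \<circ> inv_into (fst c) (snd c)"

text \<open>
  In a chart \<open>c\<close> with coordinate \<open>z\<close> the 1-form is \<open>coeff X c z dz\<close>.
\<close>

record 'a surface_with_form =
  atlas :: "'a chart set"
  coeff :: "'a chart \<Rightarrow> complex \<Rightarrow> complex"

definition riemann_surface :: "'a::{t2_space,second_countable_topology} chart set \<Rightarrow> bool" where
  "riemann_surface A \<longleftrightarrow>
     connected (UNIV :: 'a set) \<and>
     (\<forall>c\<in>A. is_chart c) \<and> (\<Union>c\<in>A. fst c) = UNIV \<and>
     (\<forall>c\<in>A. \<forall>d\<in>A. in_charts c d id holomorphic_on snd c ` (fst c \<inter> fst d))"

definition holomorphic_form :: "'a chart set \<Rightarrow> ('a chart \<Rightarrow> complex \<Rightarrow> complex) \<Rightarrow> bool" where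
  "holomorphic_form A a \<longleftrightarrow>
     (\<forall>c\<in>A. a c holomorphic_on snd c ` fst c) \<and>
     (\<forall>c\<in>A. \<forall>d\<in>A. \<forall>x \<in> fst c \<inter> fst d.
        a c (snd c x) = a d (snd d x) * deriv (in_charts c d id) (snd c x))"

definition zeros :: "'a surface_with_form \<Rightarrow> 'a set" where
  "zeros X = {x. \<exists>c\<in>atlas X. x \<in> fst c \<and> coeff X c (snd c x) = 0}"

definition translation_surface ::
    "'a::{t2_space,second_countable_topology} surface_with_form \<Rightarrow> bool" where
  "translation_surface X \<longleftrightarrow>
     riemann_surface (atlas X) \<and> holomorphic_form (atlas X) (coeff X) \<and> zeros X \<noteq> UNIV"

text \<open>
  A translation chart is a chart \<open>\<psi>\<close> away from the zeros with \<open>d\<psi> = \<alpha>\<close>; on a connected domain these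
  are the charts \<open>q \<mapsto> \<integral>\<^sub>p\<^sup>q \<alpha>\<close>, up to an additive constant.
\<close>

definition translation_chart :: "'a::topological_space surface_with_form \<Rightarrow> 'a chart \<Rightarrow> bool" where
  "translation_chart X e \<longleftrightarrow>
     is_chart e \<and> fst e \<inter> zeros X = {} \<and>
     (\<forall>c\<in>atlas X. \<forall>x \<in> fst c \<inter> fst e.
        (in_charts c e id has_field_derivative coeff X c (snd c x)) (at (snd c x)))"

section \<open>Lebesgue measure\<close>

definition is_area_measure :: "'a::topological_space surface_with_form \<Rightarrow> 'a measure \<Rightarrow> bool" where
  "is_area_measure X M \<longleftrightarrow>
     sets M = sets borel \<and> emeasure M (zeros X) = 0 \<and>
     (\<forall>U \<psi> B. translation_chart X (U, \<psi>) \<longrightarrow> B \<in> sets borel \<longrightarrow> B \<subseteq> U \<longrightarrow>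
        emeasure M B = emeasure lborel (\<psi> ` B))"

text \<open>
  On a translation surface exactly one measure satisfies \<^const>\<open>is_area_measure\<close>: changes of
  translation charts are locally translations, and countably many translation charts cover the
  complement of the zeros.
\<close>

definition area_measure :: "'a::topological_space surface_with_form \<Rightarrow> 'a measure" where
  "area_measure X = (THE M. is_area_measure X M)"

definition finite_area :: "'a::topological_space surface_with_form \<Rightarrow> bool" where
  "finite_area X \<longleftrightarrow> emeasure (area_measure X) UNIV < \<infinity>"

definition lebesgue_prob :: "'a::topological_space surface_with_form \<Rightarrow> 'a measure" where
  "lebesgue_prob X = scale_measure (inverse (emeasure (area_measure X) UNIV)) (area_measure X)"

section \<open>The translation flow\<close>

text \<open>
  \<open>flow_line X \<gamma> t\<close>: on the segment between \<open>0\<close> and \<open>t\<close> (which may be negative), \<open>\<gamma>\<close> moves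
  horizontally with unit speed in translation charts.
\<close>

definition flow_line :: "'a::topological_space surface_with_form \<Rightarrow> (real \<Rightarrow> 'a) \<Rightarrow> real \<Rightarrow> bool" where
  "flow_line X \<gamma> t \<longleftrightarrow>
     (\<forall>s \<in> closed_segment 0 t. \<exists>U \<psi>. translation_chart X (U, \<psi>) \<and> \<gamma> s \<in> U \<and>
        (\<forall>\<^sub>F r in at s within closed_segment 0 t.
           \<gamma> r \<in> U \<and> \<psi> (\<gamma> r) = \<psi> (\<gamma> s) + of_real (r - s)))"

definition flow_domain :: "'a::topological_space surface_with_form \<Rightarrow> real \<Rightarrow> 'a set" where
  "flow_domain X t = {x. \<exists>\<gamma>. flow_line X \<gamma> t \<and> \<gamma> 0 = x}"

definition flow :: "'a::topological_space surface_with_form \<Rightarrow> real \<Rightarrow> 'a \<Rightarrow> 'a" where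
  "flow X t x = (THE y. \<exists>\<gamma>. flow_line X \<gamma> t \<and> \<gamma> 0 = x \<and> \<gamma> t = y)"

definition flow_preimage :: "'a::topological_space surface_with_form \<Rightarrow> real \<Rightarrow> 'a set \<Rightarrow> 'a set" where
  "flow_preimage X t B = {x \<in> flow_domain X t. flow X t x \<in> B}"

definition flow_defined_ae :: "'a::topological_space surface_with_form \<Rightarrow> bool" where
  "flow_defined_ae X \<longleftrightarrow> (\<forall>t. AE x in lebesgue_prob X. x \<in> flow_domain X t)"

text \<open>
  Taking \<open>B = UNIV\<close> shows that for a finite invariant measure each time-\<open>t\<close> map is defined almost
  everywhere.
\<close>

definition flow_invariant :: "'a::topological_space surface_with_form \<Rightarrow> 'a measure \<Rightarrow> bool" where
  "flow_invariant X \<nu> \<longleftrightarrow>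
     (\<forall>t. \<forall>B \<in> sets borel. emeasure \<nu> (flow_preimage X t B) = emeasure \<nu> B)"

definition flow_ergodic :: "'a::topological_space surface_with_form \<Rightarrow> bool" where
  "flow_ergodic X \<longleftrightarrow>
     (\<forall>B \<in> sets borel.
        (\<forall>t. AE x in lebesgue_prob X. x \<in> flow_preimage X t B \<longleftrightarrow> x \<in> B) \<longrightarrow>
        (AE x in lebesgue_prob X. x \<in> B) \<or> (AE x in lebesgue_prob X. x \<notin> B))"

section \<open>Covers\<close>

definition finite_translation_cover ::
    "'b::topological_space surface_with_form \<Rightarrow> ('b \<Rightarrow> 'a) \<Rightarrow> 'a::topological_space surface_with_form \<Rightarrow> bool" where
  "finite_translation_cover Y p X \<longleftrightarrow>
     covering_space UNIV p UNIV \<and> (\<forall>x. finite (p -` {x})) \<and>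
     (\<forall>c\<in>atlas Y. \<forall>d\<in>atlas X.
        in_charts c d p holomorphic_on snd c ` (fst c \<inter> p -` fst d) \<and>
        (\<forall>y \<in> fst c \<inter> p -` fst d.
           coeff Y c (snd c y) = coeff X d (snd d (p y)) * deriv (in_charts c d p) (snd c y)))"

section \<open>Topological type\<close>

definition loops :: "'a::topological_space \<Rightarrow> (real \<Rightarrow> 'a) set" where
  "loops x = {g. path g \<and> pathstart g = x \<and> pathfinish g = x}"

definition loop_homotopy :: "'a::topological_space \<Rightarrow> ((real \<Rightarrow> 'a) \<times> (real \<Rightarrow> 'a)) set" where
  "loop_homotopy x = {(g, h). g \<in> loops x \<and> h \<in> loops x \<and> homotopic_paths UNIV g h}"

definition fundamental_group :: "'a::topological_space \<Rightarrow> (real \<Rightarrow> 'a) set monoid" where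
  "fundamental_group x =
     \<lparr>carrier = loops x // loop_homotopy x,
      monoid.mult = (\<lambda>P Q. \<Union>g\<in>P. \<Union>h\<in>Q. loop_homotopy x `` {g +++ h}),
      one = loop_homotopy x `` {\<lambda>_. x}\<rparr>"

definition finitely_generated_group :: "('g, 'm) monoid_scheme \<Rightarrow> bool" where
  "finitely_generated_group G \<longleftrightarrow> (\<exists>F. finite F \<and> F \<subseteq> carrier G \<and> generate G F = carrier G)"

text \<open>
  On a connected surface the choice of base point does not matter.
\<close>

definition infinite_topological_type :: "'a::topological_space itself \<Rightarrow> bool" where
  "infinite_topological_type _ \<longleftrightarrow> (\<exists>x::'a. \<not> finitely_generated_group (fundamental_group x))"

end

theory Submission
  imports Defs "HOL-Complex_Analysis.Conformal_Mappings"
begin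

text \<open>
  Let \<open>\<lambda>'\<close> and \<open>\<lambda>\<close> be the Lebesgue probability measures on the cover and on the base. If \<open>\<nu>\<close> projects
  to \<open>\<lambda>\<close>, then \<open>\<nu>\<close> is absolutely continuous with respect to \<open>\<lambda>'\<close>: the covering map is locally a
  translation, so it sends a \<open>\<lambda>'\<close>-null set to a \<open>\<lambda>\<close>-null set, whose preimage is \<open>\<nu>\<close>-null. An invariant
  probability measure that is absolutely continuous with respect to an ergodic invariant one equals it,
  because its density is invariant and hence constant. Conversely \<open>\<lambda>'\<close> is invariant because the time
  \<open>t\<close> map is an injective local translation off a null set, and it projects to \<open>\<lambda>\<close> because the number
  of sheets is constant.
\<close>

section \<open>Borel partitions and charts\<close>

text \<open>The covering map and the time \<open>t\<close> maps are treated together as instances of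
  \<open>local_translation\<close>. Planar Lebesgue measure is translation invariant, so such a map
  preserves the area of small Borel sets. A countable Borel partition makes this global: injective
  maps preserve area, and noninjective ones still send null sets to null sets. The first case serves
  the flow, the second the covering map. The main obstacle is that nothing is globally defined at
  the outset. \<open>area_measure\<close> and \<open>flow\<close> are definite descriptions, so the
  measure has to be glued from charts and flow lines have to be shown unique before either can be
  computed. The time \<open>t\<close> map lives only on an open set depending on \<open>t\<close>.
  Its inverse is the time \<open>-t\<close> map, so preimages are rewritten as images under the
  reversed flow. The zeros of \<alpha> are null by the definition of the area measure. They are cut
  away wherever a local translation is required, which is harmless for the cover because
  \<open>p\<close> pulls the zeros of \<alpha> back exactly to the zeros of the pulled-back
  form.\<close>

lemma borel_partition_subordinate:
  fixes B :: "'a::second_countable_topology set"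
  assumes B: "B \<in> sets borel"
    and cover: "\<forall>x\<in>B. \<exists>W. open W \<and> x \<in> W \<and> P W"
  shows "\<exists>C :: nat \<Rightarrow> 'a set. disjoint_family C \<and> (\<forall>i. C i \<in> sets borel) \<and> (\<Union>i. C i) = B \<and>
    (\<forall>i. C i = {} \<or> (\<exists>W. P W \<and> C i \<subseteq> W))"
proof -
  define \<F> where "\<F> = {W. open W \<and> P W}"
  have "\<And>S. S \<in> \<F> \<Longrightarrow> openin (top_of_set UNIV) S"
    by (simp add: \<F>_def)
  from Lindelof_openin[OF this] obtain \<F>' where F': "\<F>' \<subseteq> \<F>" "countable \<F>'" "\<Union>\<F>' = \<Union>\<F>"
    by metis
  have sub: "B \<subseteq> \<Union>\<F>'"
    using cover F'(3) unfolding \<F>_def by blast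
  \<comment> \<open>The enumeration by \<open>nat\<close> requires a nonempty countable set.
    Inserting the empty set secures this and is the reason why the conclusion allows
    \<open>C i = {}\<close>.\<close>
  define E where "E = from_nat_into (insert {} \<F>')"
  have rE: "range E = insert {} \<F>'"
    unfolding E_def using F'(2) by (simp add: range_from_nat_into)
  define C where "C i = B \<inter> disjointed E i" for i
  have EP: "open (E i)" "E i = {} \<or> P (E i)" for i
  proof -
    have "E i \<in> insert {} \<F>'"
      using rE by blast
    then show "open (E i)" "E i = {} \<or> P (E i)"
      using F'(1) unfolding \<F>_def by auto
  qed
  show ?thesis
  proof (intro exI conjI allI)
    show "disjoint_family C"
      using disjoint_family_disjointed[of E] unfolding disjoint_family_on_def C_def by blast
    have "E i \<in> sets borel" for i
      using EP(1) by simp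
    then have "disjointed E i \<in> sets borel" for i
      using sets.range_disjointed_sets[of E borel] by blast
    then show "C i \<in> sets borel" for i
      using B by (simp add: C_def)
    have "(\<Union>i. C i) = B \<inter> (\<Union>i. disjointed E i)"
      unfolding C_def by simp
    also have "\<dots> = B"
      using sub unfolding UN_disjointed_eq rE by auto
    finally show "(\<Union>i. C i) = B" .
    show "C i = {} \<or> (\<exists>W. P W \<and> C i \<subseteq> W)" for i
      using EP(2)[of i] disjointed_subset[of E i] unfolding C_def by blast
  qed
qed

text \<open>Countable additivity over a partition into small pieces. Agreement is only asked for on
  subsets of \<open>B\<close>, so that a null set such as the zeros can be removed
  beforehand.\<close>

lemma emeasure_eq_if_locally_eq:
  fixes M N :: "'a::second_countable_topology measure"
  assumes M: "sets M = sets borel" and N: "sets N = sets borel"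
    and B: "B \<in> sets borel"
    and local: "\<forall>x\<in>B. \<exists>W. open W \<and> x \<in> W \<and>
      (\<forall>A\<in>sets borel. A \<subseteq> W \<inter> B \<longrightarrow> emeasure M A = emeasure N A)"
  shows "emeasure M B = emeasure N B"
proof -
  obtain C :: "nat \<Rightarrow> 'a set" where C: "disjoint_family C" "\<forall>i. C i \<in> sets borel" "(\<Union>i. C i) = B"
    "\<forall>i. C i = {} \<or> (\<exists>W. (\<forall>A\<in>sets borel. A \<subseteq> W \<inter> B \<longrightarrow> emeasure M A = emeasure N A) \<and> C i \<subseteq> W)"
    using borel_partition_subordinate[OF B local] by blast
  have "emeasure M (C i) = emeasure N (C i)" for i
  proof (cases "C i = {}")
    case False
    then obtain W where "\<forall>A\<in>sets borel. A \<subseteq> W \<inter> B \<longrightarrow> emeasure M A = emeasure N A" "C i \<subseteq> W"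
      using C(4) by blast
    moreover have "C i \<subseteq> B"
      using C(3) by blast
    ultimately show ?thesis
      using C(2) by blast
  qed simp
  then have "(\<Sum>i. emeasure M (C i)) = (\<Sum>i. emeasure N (C i))"
    by simp
  moreover have "(\<Sum>i. emeasure M (C i)) = emeasure M B" "(\<Sum>i. emeasure N (C i)) = emeasure N B"
    using C(1-3) M N by (auto intro!: suminf_emeasure)
  ultimately show ?thesis
    by simp
qed

section \<open>Open and Borel sets in a single chart\<close>

lemma is_chart_inj: "is_chart (U, \<psi>) \<Longrightarrow> inj_on \<psi> U"
  unfolding is_chart_def homeomorphism_def by (auto intro: inj_on_inverseI)

lemma is_chart_open: "is_chart (U, \<psi>) \<Longrightarrow> open U" "is_chart (U, \<psi>) \<Longrightarrow> open (\<psi> ` U)"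
  unfolding is_chart_def by auto

lemma is_chart_continuous: "is_chart (U, \<psi>) \<Longrightarrow> continuous_on U \<psi>"
  unfolding is_chart_def homeomorphism_def by auto

text \<open>The definition of a chart provides some inverse, whereas \<open>in_charts\<close> uses
  \<open>inv_into\<close>. On the image the two coincide, which makes \<open>inv_into\<close>
  continuous there.\<close>

lemma is_chart_homeomorphism:
  assumes "is_chart (U, \<psi>)"
  shows "homeomorphism U (\<psi> ` U) \<psi> (inv_into U \<psi>)"
proof -
  obtain g where g: "homeomorphism U (\<psi> ` U) \<psi> g"
    using assms unfolding is_chart_def by auto
  have "inv_into U \<psi> z = g z" if "z \<in> \<psi> ` U" for z
    using that g is_chart_inj[OF assms] by (auto simp: homeomorphism_def)
  then show ?thesis
    by (intro homeomorphism_cong[OF g]) auto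
qed

lemma is_chart_inv_continuous: "is_chart (U, \<psi>) \<Longrightarrow> continuous_on (\<psi> ` U) (inv_into U \<psi>)"
  using is_chart_homeomorphism unfolding homeomorphism_def by blast

lemma is_chart_open_image:
  assumes c: "is_chart (U, \<psi>)" and W: "open W" "W \<subseteq> U"
  shows "open (\<psi> ` W)"
proof -
  have "\<psi> ` W = \<psi> ` U \<inter> inv_into U \<psi> -` W"
    using W is_chart_inj[OF c] by (force simp: inv_into_f_f)
  then show ?thesis
    using continuous_open_preimage[OF is_chart_inv_continuous[OF c] is_chart_open(2)[OF c] W(1)] by simp
qed

lemma is_chart_open_preimage:
  assumes "is_chart (U, \<psi>)" "open Z"
  shows "open (U \<inter> \<psi> -` Z)"
  by (rule continuous_open_preimage[OF is_chart_continuous[OF assms(1)] is_chart_open(1)[OF assms(1)] assms(2)])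

lemma borel_continuous_preimage:
  assumes f: "continuous_on U f" and U: "U \<in> sets borel" and Z: "Z \<in> sets borel"
  shows "U \<inter> f -` Z \<in> sets borel"
proof -
  have "f -` Z \<inter> space (restrict_space borel U) \<in> sets (restrict_space borel U)"
    using borel_measurable_continuous_on_restrict[OF f] Z by (rule measurable_sets)
  then have "f -` Z \<inter> U \<in> sets borel"
    using U by (simp add: sets_restrict_space_iff space_restrict_space)
  then show ?thesis
    by (simp add: inf_commute)
qed

lemma is_chart_borel_preimage:
  assumes c: "is_chart (U, \<psi>)" and Z: "Z \<in> sets borel"
  shows "U \<inter> \<psi> -` Z \<in> sets borel"
  using borel_continuous_preimage[OF is_chart_continuous[OF c] _ Z] is_chart_open(1)[OF c] by simp

text \<open>Continuous images of Borel sets need not be Borel. Here the image is also a preimage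
  under the continuous inverse.\<close>

lemma is_chart_borel_image:
  assumes c: "is_chart (U, \<psi>)" and B: "B \<in> sets borel" "B \<subseteq> U"
  shows "\<psi> ` B \<in> sets borel"
proof -
  have "\<psi> ` B = \<psi> ` U \<inter> inv_into U \<psi> -` B"
    using B is_chart_inj[OF c] by (force simp: inv_into_f_f)
  then show ?thesis
    using borel_continuous_preimage[OF is_chart_inv_continuous[OF c] _ B(1)] is_chart_open(2)[OF c] by simp
qed

text \<open>Injectivity of the chart keeps the images disjoint, so planar area read through a chart
  is countably additive.\<close>

lemma is_chart_suminf:
  assumes c: "is_chart (U, \<psi>)" and "disjoint_family C" "\<And>i::nat. C i \<in> sets borel" "\<And>i. C i \<subseteq> U"
  shows "(\<Sum>i. emeasure lborel (\<psi> ` C i)) = emeasure lborel (\<psi> ` (\<Union>i. C i))"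
proof -
  have "disjoint_family (\<lambda>i. \<psi> ` C i)"
    using assms(2,4) is_chart_inj[OF c] unfolding disjoint_family_on_def
    by (metis (no_types, lifting) image_empty inj_on_image_Int)
  then show ?thesis
    using is_chart_borel_image[OF c assms(3,4)] by (simp add: suminf_emeasure image_UN image_subset_iff)
qed

lemma emeasure_lborel_translate:
  fixes A :: "'a::euclidean_space set"
  assumes "A \<in> sets borel"
  shows "emeasure lborel ((\<lambda>z. z + k) ` A) = emeasure lborel A"
    and "(\<lambda>z. z + k) ` A \<in> sets borel"
proof -
  have eq: "(\<lambda>z. z + k) ` A = (+) (- k) -` A"
    by (force simp: image_iff algebra_simps)
  have m: "(+) (- k) \<in> borel_measurable borel"
    by simp
  show "(\<lambda>z. z + k) ` A \<in> sets borel"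
    unfolding eq using measurable_sets[OF m assms] by simp
  have "emeasure lborel A = emeasure (distr lborel borel ((+) (-k))) A"
    by (simp add: lborel_distr_plus)
  also have "\<dots> = emeasure lborel ((\<lambda>z. z + k) ` A)"
    using assms by (subst emeasure_distr) (auto simp: eq)
  finally show "emeasure lborel ((\<lambda>z. z + k) ` A) = emeasure lborel A" ..
qed

section \<open>Translation charts\<close>

lemma in_charts_eq: "in_charts c d f z = snd d (f (inv_into (fst c) (snd c) z))"
  by (simp add: in_charts_def)

context
  fixes X :: "'a::{t2_space,second_countable_topology} surface_with_form"
  assumes X: "translation_surface X"
begin

lemma atlas_chart: "c \<in> atlas X \<Longrightarrow> is_chart (fst c, snd c)"
  using X unfolding translation_surface_def riemann_surface_def by simp

lemma atlas_covers: "\<exists>c\<in>atlas X. x \<in> fst c"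
  using X unfolding translation_surface_def riemann_surface_def by blast

lemma atlas_inv_into: "c \<in> atlas X \<Longrightarrow> x \<in> fst c \<Longrightarrow> inv_into (fst c) (snd c) (snd c x) = x"
  using is_chart_inj[OF atlas_chart] by (simp add: inv_into_f_f)

lemma connected_surface: "connected (UNIV :: 'a set)"
  using X unfolding translation_surface_def riemann_surface_def by simp

lemma coeff_holomorphic: "c \<in> atlas X \<Longrightarrow> coeff X c holomorphic_on snd c ` fst c"
  using X unfolding translation_surface_def holomorphic_form_def by simp

lemma coeff_change:
  assumes "c \<in> atlas X" "d \<in> atlas X" "x \<in> fst c" "x \<in> fst d"
  shows "coeff X c (snd c x) = coeff X d (snd d x) * deriv (in_charts c d id) (snd c x)"
  using X assms unfolding translation_surface_def holomorphic_form_def by blast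

lemma transition_has_derivative:
  assumes "c \<in> atlas X" "d \<in> atlas X" "x \<in> fst c" "x \<in> fst d"
  shows "(in_charts c d id has_field_derivative deriv (in_charts c d id) (snd c x)) (at (snd c x))"
proof -
  have "in_charts c d id holomorphic_on snd c ` (fst c \<inter> fst d)"
    using X assms unfolding translation_surface_def riemann_surface_def by blast
  moreover have "open (snd c ` (fst c \<inter> fst d))"
    using is_chart_open(1)[OF atlas_chart[OF assms(1)]] is_chart_open(1)[OF atlas_chart[OF assms(2)]]
    by (intro is_chart_open_image[OF atlas_chart[OF assms(1)]]) auto
  ultimately show ?thesis
    using assms by (intro holomorphic_derivI) auto
qed

text \<open>By the change-of-chart rule the coefficient in \<open>c\<close> is a multiple of the
  coefficient in any other chart, so a zero seen in one chart is seen in all charts around the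
  point.\<close>

lemma zeros_iff:
  assumes "c \<in> atlas X" "x \<in> fst c"
  shows "x \<in> zeros X \<longleftrightarrow> coeff X c (snd c x) = 0"
proof
  assume "x \<in> zeros X"
  then obtain d where d: "d \<in> atlas X" "x \<in> fst d" "coeff X d (snd d x) = 0"
    unfolding zeros_def by blast
  show "coeff X c (snd c x) = 0"
    using coeff_change[OF assms(1) d(1) assms(2) d(2)] d(3) by simp
qed (use assms in \<open>auto simp: zeros_def\<close>)

text \<open>In a coordinate the form is \<open>a z dz\<close>. A primitive \<open>G\<close> of
  \<open>a\<close> on a ball has nonzero derivative at the given point, hence is injective nearby,
  and \<open>G\<close> after the coordinate is the required chart.\<close>

lemma translation_chart_exists:
  assumes x: "x \<notin> zeros X"
  shows "\<exists>U \<psi>. translation_chart X (U, \<psi>) \<and> x \<in> U"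
proof -
  obtain c where c: "c \<in> atlas X" "x \<in> fst c"
    using atlas_covers by blast
  define V \<phi> a where "V = fst c" and "\<phi> = snd c" and "a = coeff X c"
  have ch: "is_chart (V, \<phi>)" and xV: "x \<in> V"
    using c atlas_chart unfolding V_def \<phi>_def by auto
  obtain r where r: "r > 0" "ball (\<phi> x) r \<subseteq> \<phi> ` V"
    using is_chart_open(2)[OF ch] xV by (meson imageI openE)
  have a_hol: "a holomorphic_on ball (\<phi> x) r"
    using coeff_holomorphic[OF c(1)] r(2) unfolding a_def V_def \<phi>_def
    by (rule holomorphic_on_subset)
  obtain G where "\<And>z. z \<in> ball (\<phi> x) r \<Longrightarrow> (G has_field_derivative a z) (at z within ball (\<phi> x) r)"
    using holomorphic_convex_primitive'[OF convex_ball open_ball a_hol] by blast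
  then have G: "(G has_field_derivative a z) (at z)" if "z \<in> ball (\<phi> x) r" for z
    using that by (metis at_within_open open_ball)
  have G_hol: "G holomorphic_on ball (\<phi> x) r"
    unfolding holomorphic_on_open[OF open_ball] using G by blast
  have "deriv G (\<phi> x) \<noteq> 0"
    using DERIV_imp_deriv[OF G] r(1) x zeros_iff[OF c] unfolding a_def \<phi>_def by simp
  then obtain s where s: "s > 0" "ball (\<phi> x) s \<subseteq> ball (\<phi> x) r" "inj_on G (ball (\<phi> x) s)"
    using has_complex_derivative_locally_injective[OF G_hol, of "\<phi> x"] r(1) by auto
  define Z where "Z = ball (\<phi> x) s"
  have Z: "open Z" "Z \<subseteq> \<phi> ` V" "inj_on G Z" "\<phi> x \<in> Z"
    using r s by (auto simp: Z_def)
  have GZ: "(G has_field_derivative a z) (at z)" if "z \<in> Z" for z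
    using G s(2) that by (auto simp: Z_def)
  have G_hol_Z: "G holomorphic_on Z"
    using G_hol s(2) unfolding Z_def by (rule holomorphic_on_subset)
  \<comment> \<open>An injective holomorphic map has nowhere vanishing derivative, so the shrunken
    domain avoids the zeros of the form altogether.\<close>
  have a_nz: "a z \<noteq> 0" if "z \<in> Z" for z
    using holomorphic_injective_imp_regular[OF G_hol_Z Z(1,3) that] DERIV_imp_deriv[OF GZ[OF that]] by simp
  define U where "U = V \<inter> \<phi> -` Z"
  have U: "open U" "\<phi> ` U = Z" "x \<in> U" "U \<subseteq> V"
    using is_chart_open_preimage[OF ch Z(1)] Z xV unfolding U_def by auto
  have "homeomorphism U Z \<phi> (inv_into V \<phi>)"
    using homeomorphism_of_subsets[OF is_chart_homeomorphism[OF ch] U(4) Z(2) U(2)] .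
  moreover obtain g where "homeomorphism Z (G ` Z) G g"
  proof -
    obtain g where "g holomorphic_on (G ` Z)" "\<And>z. z \<in> Z \<Longrightarrow> g (G z) = z"
      using holomorphic_has_inverse[OF G_hol_Z Z(1,3)] by metis
    then show ?thesis
      using that G_hol_Z unfolding homeomorphism_def
      by (force dest: holomorphic_on_imp_continuous_on simp: image_image)
  qed
  ultimately have "homeomorphism U (G ` Z) (G \<circ> \<phi>) (inv_into V \<phi> \<circ> g)"
    by (rule homeomorphism_compose)
  moreover have "open (G ` Z)"
    using open_mapping_thm3[OF G_hol_Z Z(1,3)] .
  moreover have "(G \<circ> \<phi>) ` U = G ` Z"
    by (simp only: image_comp[symmetric] U(2))
  ultimately have chart: "is_chart (U, G \<circ> \<phi>)"
    unfolding is_chart_def using U(1) by auto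
  have "y \<notin> zeros X" if "y \<in> U" for y
    using zeros_iff[OF c(1), of y] a_nz[of "\<phi> y"] that unfolding U_def a_def V_def \<phi>_def by auto
  moreover have "(in_charts d (U, G \<circ> \<phi>) id has_field_derivative coeff X d (snd d y)) (at (snd d y))"
    if d: "d \<in> atlas X" and y: "y \<in> fst d \<inter> U" for d y
  proof -
    \<comment> \<open>Seen from another atlas chart \<open>d\<close>, the new coordinate is
      \<open>G\<close> after the transition \<open>?h\<close>. The chain rule then produces exactly
      the transformation law of the form.\<close>
    let ?h = "in_charts d c id"
    have yc: "y \<in> fst c"
      using y U(4) unfolding V_def by auto
    have hy: "?h (snd d y) = \<phi> y"
      using atlas_inv_into[OF d] y by (simp add: in_charts_eq \<phi>_def)
    have "(G has_field_derivative a (\<phi> y)) (at (?h (snd d y)))"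
      unfolding hy using y U(2) by (intro GZ) auto
    from DERIV_chain[OF this transition_has_derivative[OF d c(1), of y]]
    have "(G \<circ> ?h has_field_derivative a (\<phi> y) * deriv ?h (snd d y)) (at (snd d y))"
      using y yc by simp
    moreover have "G \<circ> ?h = in_charts d (U, G \<circ> \<phi>) id"
      by (auto simp: in_charts_eq \<phi>_def)
    moreover have "a (\<phi> y) * deriv ?h (snd d y) = coeff X d (snd d y)"
      using coeff_change[OF d c(1), of y] y yc unfolding a_def \<phi>_def by simp
    ultimately show ?thesis
      by simp
  qed
  ultimately have "translation_chart X (U, G \<circ> \<phi>)"
    unfolding translation_chart_def using chart by auto
  then show ?thesis
    using U(3) by blast
qed

text \<open>Two primitives of the same form have a difference with zero derivative. The overlap may
  be disconnected, so the difference is only locally constant, and \<open>W\<close> is taken as the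
  preimage of a ball.\<close>

lemma translation_chart_change:
  assumes e: "translation_chart X (U, \<psi>)" "translation_chart X (V, \<xi>)" and x: "x \<in> U" "x \<in> V"
  shows "\<exists>W k. open W \<and> x \<in> W \<and> W \<subseteq> U \<inter> V \<and> (\<forall>y\<in>W. \<xi> y = \<psi> y + k)"
proof -
  obtain c where c: "c \<in> atlas X" "x \<in> fst c"
    using atlas_covers by blast
  define \<phi> i where "\<phi> = snd c" and "i = inv_into (fst c) \<phi>"
  have ch: "is_chart (fst c, \<phi>)"
    using atlas_chart[OF c(1)] by (simp add: \<phi>_def)
  have inv: "i (\<phi> y) = y" if "y \<in> fst c" for y
    using atlas_inv_into[OF c(1) that] by (simp add: \<phi>_def i_def)
  let ?N = "fst c \<inter> U \<inter> V"
  have "open U" "open V"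
    using e unfolding translation_chart_def by (auto dest: is_chart_open)
  then have "open (\<phi> ` ?N)"
    using is_chart_open_image[OF ch, of ?N] is_chart_open(1)[OF ch] by blast
  then obtain r where r: "r > 0" "ball (\<phi> x) r \<subseteq> \<phi> ` ?N"
    using c x by (meson IntI imageI openE)
  have d0: "((\<lambda>z. \<xi> (i z) - \<psi> (i z)) has_field_derivative 0) (at z)" if z: "z \<in> ball (\<phi> x) r" for z
  proof -
    obtain y where y: "y \<in> ?N" "z = \<phi> y"
      using z r(2) by auto
    have "(in_charts c (U, \<psi>) id has_field_derivative coeff X c z) (at z)"
      "(in_charts c (V, \<xi>) id has_field_derivative coeff X c z) (at z)"
      using e c(1) y unfolding translation_chart_def \<phi>_def by auto
    moreover have "in_charts c (U, \<psi>) id = (\<lambda>z. \<psi> (i z))" "in_charts c (V, \<xi>) id = (\<lambda>z. \<xi> (i z))"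
      by (auto simp: in_charts_eq i_def \<phi>_def)
    ultimately show ?thesis
      using DERIV_diff by fastforce
  qed
  have "\<exists>k. \<forall>z\<in>ball (\<phi> x) r. \<xi> (i z) - \<psi> (i z) = k"
    by (rule has_field_derivative_zero_constant[OF convex_ball])
      (use d0 in \<open>auto intro: has_field_derivative_at_within\<close>)
  then obtain k where k: "\<And>z. z \<in> ball (\<phi> x) r \<Longrightarrow> \<xi> (i z) - \<psi> (i z) = k"
    by blast
  define W where "W = fst c \<inter> \<phi> -` ball (\<phi> x) r"
  have "open W"
    unfolding W_def by (rule is_chart_open_preimage[OF ch open_ball])
  moreover have "x \<in> W"
    using c r(1) by (simp add: W_def)
  moreover have "W \<subseteq> U \<inter> V"
    using r(2) is_chart_inj[OF ch] unfolding W_def inj_on_def by blast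
  moreover have "\<xi> y = \<psi> y + k" if "y \<in> W" for y
    using k[of "\<phi> y"] inv[of y] that unfolding W_def by (auto simp: algebra_simps)
  ultimately show ?thesis
    by blast
qed

lemma open_Compl_zeros: "open (- zeros X)"
proof (rule Topological_Spaces.openI)
  fix x assume "x \<in> - zeros X"
  then obtain U \<psi> where "translation_chart X (U, \<psi>)" "x \<in> U"
    using translation_chart_exists by blast
  then show "\<exists>T. open T \<and> x \<in> T \<and> T \<subseteq> - zeros X"
    unfolding translation_chart_def by (auto dest!: is_chart_open(1))
qed

lemma zeros_borel: "zeros X \<in> sets borel"
  using open_Compl_zeros by (simp add: borel_closed closed_def)

end

section \<open>The area measure\<close>

lemma translation_chart_chart: "translation_chart X (U, \<psi>) \<Longrightarrow> is_chart (U, \<psi>)"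
  unfolding translation_chart_def by simp

text \<open>The translation constant may vary over the overlap. Countably many Borel pieces, each
  with one constant, reduce the claim to translation invariance in the plane.\<close>

lemma emeasure_chart_change:
  fixes X :: "'a::{t2_space,second_countable_topology} surface_with_form"
  assumes X: "translation_surface X"
    and e: "translation_chart X (U, \<psi>)" "translation_chart X (V, \<xi>)"
    and B: "B \<in> sets borel" "B \<subseteq> U" "B \<subseteq> V"
  shows "emeasure lborel (\<psi> ` B) = emeasure lborel (\<xi> ` B)"
proof -
  have "\<forall>x\<in>B. \<exists>W. open W \<and> x \<in> W \<and> (\<exists>k. \<forall>y\<in>W. \<xi> y = \<psi> y + k)"
  proof
    fix x assume "x \<in> B"
    then have "x \<in> U" "x \<in> V"
      using B(2,3) by auto
    from translation_chart_change[OF X e this]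
    show "\<exists>W. open W \<and> x \<in> W \<and> (\<exists>k. \<forall>y\<in>W. \<xi> y = \<psi> y + k)"
      by blast
  qed
  from borel_partition_subordinate[OF B(1) this] obtain C :: "nat \<Rightarrow> 'a set" where
    C: "disjoint_family C" "\<forall>i. C i \<in> sets borel" "(\<Union>i. C i) = B"
    "\<forall>i. C i = {} \<or> (\<exists>W. (\<exists>k. \<forall>y\<in>W. \<xi> y = \<psi> y + k) \<and> C i \<subseteq> W)"
    by blast
  have sub: "C i \<subseteq> U" "C i \<subseteq> V" for i
    using C(3) B(2,3) by blast+
  have "emeasure lborel (\<psi> ` C i) = emeasure lborel (\<xi> ` C i)" for i
  proof (cases "C i = {}")
    case False
    then obtain k where k: "\<And>y. y \<in> C i \<Longrightarrow> \<xi> y = \<psi> y + k"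
      using C(4) by blast
    then have "\<xi> ` C i = (\<lambda>z. z + k) ` \<psi> ` C i"
      unfolding image_image by (rule image_cong[OF refl])
    moreover have "\<psi> ` C i \<in> sets borel"
      using is_chart_borel_image[OF translation_chart_chart[OF e(1)]] C(2) sub by blast
    ultimately show ?thesis
      by (simp add: emeasure_lborel_translate)
  qed simp
  then show ?thesis
    using is_chart_suminf[OF translation_chart_chart[OF e(1)] C(1)] C(2,3) sub
      is_chart_suminf[OF translation_chart_chart[OF e(2)] C(1)] by simp
qed

text \<open>Tonelli, with one sum read as an integral over the counting measure on
  \<open>nat\<close>.\<close>

lemma suminf_swap_ennreal:
  fixes f :: "nat \<Rightarrow> nat \<Rightarrow> ennreal"
  shows "(\<Sum>i. \<Sum>j. f i j) = (\<Sum>j. \<Sum>i. f i j)"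
  using nn_integral_suminf[of "\<lambda>j i. f i j" "count_space UNIV"] by (simp add: nn_integral_count_space_nat)

text \<open>The complement of the zeros is cut into Borel pieces, each inside a translation chart,
  and planar areas of the pieces are added. Independence of the chosen charts is
  \<open>emeasure_chart_change\<close>.\<close>

lemma area_measure_exists:
  fixes X :: "'a::{t2_space,second_countable_topology} surface_with_form"
  assumes X: "translation_surface X"
  shows "\<exists>M. is_area_measure X M"
proof -
  let ?Z = "zeros X"
  have "- ?Z \<in> sets borel"
    using open_Compl_zeros[OF X] by simp
  moreover have "\<forall>x\<in>- ?Z. \<exists>W. open W \<and> x \<in> W \<and> (\<exists>\<psi>. translation_chart X (W, \<psi>))"
  proof
    fix x assume "x \<in> - ?Z"
    then obtain U \<psi> where U: "translation_chart X (U, \<psi>)" "x \<in> U"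
      using translation_chart_exists[OF X, of x] by auto
    then show "\<exists>W. open W \<and> x \<in> W \<and> (\<exists>\<psi>. translation_chart X (W, \<psi>))"
      using is_chart_open(1)[OF translation_chart_chart[OF U(1)]] by auto
  qed
  ultimately obtain C :: "nat \<Rightarrow> 'a set" where
    C: "disjoint_family C" "\<forall>i. C i \<in> sets borel" "(\<Union>i. C i) = - ?Z"
    "\<forall>i. C i = {} \<or> (\<exists>W. (\<exists>\<psi>. translation_chart X (W, \<psi>)) \<and> C i \<subseteq> W)"
    using borel_partition_subordinate[of "- ?Z" "\<lambda>W. \<exists>\<psi>. translation_chart X (W, \<psi>)"] by blast
  \<comment> \<open>Empty pieces of the partition also need a chart; the one with empty domain
    serves.\<close>
  have "translation_chart X ({}, \<psi>)" for \<psi>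
    unfolding translation_chart_def is_chart_def by (auto simp: homeomorphism_def)
  then have "\<forall>i. \<exists>e. translation_chart X e \<and> C i \<subseteq> fst e"
    using C(4) by (metis empty_subsetI fst_conv)
  then obtain e where e: "\<And>i. translation_chart X (e i)" "\<And>i. C i \<subseteq> fst (e i)"
    by metis
  have echart: "translation_chart X (fst (e i), snd (e i))" for i
    using e(1) by simp
  \<comment> \<open>The zeros meet none of the pieces \<open>C i\<close>, so they receive mass
    0.\<close>
  define \<mu> where "\<mu> B = (\<Sum>i. emeasure lborel (snd (e i) ` (B \<inter> C i)))" for B
  define M where "M = measure_of UNIV (sets borel) \<mu>"
  have "countably_additive (sets borel) \<mu>"
  proof (rule countably_additiveI)
    fix F :: "nat \<Rightarrow> 'a set"
    assume F: "range F \<subseteq> sets borel" "disjoint_family F"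
    have "(\<Sum>j. emeasure lborel (snd (e i) ` (F j \<inter> C i))) = emeasure lborel (snd (e i) ` (\<Union>j. F j \<inter> C i))" for i
    proof (rule is_chart_suminf[OF translation_chart_chart[OF echart]])
      show "disjoint_family (\<lambda>j. F j \<inter> C i)"
        using F(2) unfolding disjoint_family_on_def by blast
    qed (use F(1) C(2) e(2) in auto)
    then show "(\<Sum>j. \<mu> (F j)) = \<mu> (\<Union> (range F))"
      unfolding \<mu>_def by (subst suminf_swap_ennreal) simp
  qed
  then have M_eq: "emeasure M B = \<mu> B" if "B \<in> sets borel" for B
    unfolding M_def using sets.sigma_algebra_axioms[of "borel :: 'a measure"] that
    by (intro emeasure_measure_of_sigma) (auto simp: positive_def \<mu>_def)
  have "sets M = sets borel"
    using sets.sigma_sets_eq[of "borel :: 'a measure"] unfolding M_def by (simp add: sets_measure_of_conv)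
  moreover have "emeasure M ?Z = 0"
  proof -
    have "?Z \<inter> C i = {}" for i
      using C(3) by blast
    then show ?thesis
      using M_eq[OF zeros_borel[OF X]] by (simp add: \<mu>_def)
  qed
  moreover have "emeasure M B = emeasure lborel (\<psi> ` B)"
    if c: "translation_chart X (U, \<psi>)" and B: "B \<in> sets borel" "B \<subseteq> U" for U \<psi> B
  proof -
    have "U \<inter> ?Z = {}"
      using c unfolding translation_chart_def by simp
    then have Beq: "(\<Union>i. B \<inter> C i) = B"
      using C(3) B(2) by blast
    have "disjoint_family (\<lambda>i. B \<inter> C i)"
      using C(1) unfolding disjoint_family_on_def by blast
    then have "(\<Sum>i. emeasure lborel (\<psi> ` (B \<inter> C i))) = emeasure lborel (\<psi> ` (\<Union>i. B \<inter> C i))"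
      by (rule is_chart_suminf[OF translation_chart_chart[OF c]]) (use B C(2) in auto)
    moreover have "emeasure lborel (snd (e i) ` (B \<inter> C i)) = emeasure lborel (\<psi> ` (B \<inter> C i))" for i
      by (rule emeasure_chart_change[OF X echart c]) (use B C(2) e(2) in auto)
    ultimately show ?thesis
      unfolding M_eq[OF B(1)] \<mu>_def Beq by simp
  qed
  ultimately show ?thesis
    unfolding is_area_measure_def by blast
qed

lemma area_measure_unique:
  fixes X :: "'a::{t2_space,second_countable_topology} surface_with_form"
  assumes X: "translation_surface X" and M: "is_area_measure X M" and N: "is_area_measure X N"
  shows "M = N"
proof (rule measure_eqI)
  have sets: "sets M = sets borel" "sets N = sets borel"
    using M N unfolding is_area_measure_def by auto
  then show "sets M = sets N"
    by simp
  fix A assume "A \<in> sets M"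
  then have A: "A \<in> sets borel"
    using sets by simp
  have diff: "emeasure L (A - zeros X) = emeasure L A" if "is_area_measure X L" for L
    using that A zeros_borel[OF X] unfolding is_area_measure_def
    by (intro emeasure_Diff_null_set) (auto simp: null_sets_def)
  have "\<exists>W. open W \<and> x \<in> W \<and> (\<forall>B\<in>sets borel. B \<subseteq> W \<inter> (A - zeros X) \<longrightarrow> emeasure M B = emeasure N B)"
    if x: "x \<in> A - zeros X" for x
  proof -
    obtain U \<psi> where U: "translation_chart X (U, \<psi>)" "x \<in> U"
      using translation_chart_exists[OF X] x by blast
    then have "emeasure M B = emeasure N B" if "B \<in> sets borel" "B \<subseteq> U" for B
      using M N that unfolding is_area_measure_def by metis
    then show ?thesis
      using U(2) is_chart_open(1)[OF translation_chart_chart[OF U(1)]] by (intro exI[of _ U]) simp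
  qed
  then have "emeasure M (A - zeros X) = emeasure N (A - zeros X)"
    using A zeros_borel[OF X] by (intro emeasure_eq_if_locally_eq sets) auto
  then show "emeasure M A = emeasure N A"
    using diff M N by simp
qed

context
  fixes X :: "'a::{t2_space,second_countable_topology} surface_with_form"
  assumes X: "translation_surface X"
begin

lemma is_area_measure_area_measure: "is_area_measure X (area_measure X)"
  unfolding area_measure_def
  using area_measure_exists[OF X] area_measure_unique[OF X] by (metis theI')

lemma sets_area_measure: "sets (area_measure X) = sets borel"
  using is_area_measure_area_measure unfolding is_area_measure_def by simp

lemma space_area_measure: "space (area_measure X) = UNIV"
  using sets_eq_imp_space_eq[OF sets_area_measure] by simp

lemma emeasure_area_zeros: "emeasure (area_measure X) (zeros X) = 0"
  using is_area_measure_area_measure unfolding is_area_measure_def by simp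

lemma emeasure_area_chart:
  assumes "translation_chart X (U, \<psi>)" "B \<in> sets borel" "B \<subseteq> U"
  shows "emeasure (area_measure X) B = emeasure lborel (\<psi> ` B)"
  using is_area_measure_area_measure assms unfolding is_area_measure_def by simp

text \<open>The form is not identically zero, so some translation chart exists, and its image is a
  nonempty open subset of the plane. Normalizing to a probability measure divides by this total
  area.\<close>

lemma emeasure_area_nonzero: "emeasure (area_measure X) UNIV \<noteq> 0"
proof
  assume 0: "emeasure (area_measure X) UNIV = 0"
  obtain x where "x \<notin> zeros X"
    using X unfolding translation_surface_def by blast
  then obtain U \<psi> where U: "translation_chart X (U, \<psi>)" "x \<in> U"
    using translation_chart_exists[OF X] by blast
  have ch: "is_chart (U, \<psi>)"
    using translation_chart_chart[OF U(1)] .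
  have "emeasure (area_measure X) U \<le> emeasure (area_measure X) UNIV"
    by (rule emeasure_mono) (simp_all add: sets_area_measure)
  then have "emeasure lborel (\<psi> ` U) = 0"
    using emeasure_area_chart[OF U(1), of U] is_chart_open(1)[OF ch] 0 by simp
  then have "\<psi> ` U \<in> null_sets lborel"
    using is_chart_open(2)[OF ch] by (simp add: null_sets_def)
  then have "negligible (\<psi> ` U)"
    using null_sets_completionI by (auto simp: negligible_iff_null_sets)
  then show False
    using open_not_negligible[OF is_chart_open(2)[OF ch]] U(2) by blast
qed

end

section \<open>Local translations\<close>

text \<open>The common shape of the time \<open>t\<close> maps and of the covering map off the
  zeros. Continuity is a consequence, by \<open>open_preimage_translation\<close>.\<close>

definition local_translation ::
    "'a::topological_space surface_with_form \<Rightarrow> 'b::topological_space surface_with_form \<Rightarrow> ('a \<Rightarrow> 'b) \<Rightarrow> 'a \<Rightarrow> bool" where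
  "local_translation X Y f x \<longleftrightarrow> (\<exists>U \<psi> V \<xi> W k.
     translation_chart X (U, \<psi>) \<and> translation_chart Y (V, \<xi>) \<and> open W \<and> x \<in> W \<and> W \<subseteq> U \<and>
     f ` W \<subseteq> V \<and> (\<forall>y\<in>W. \<xi> (f y) = \<psi> y + k))"

lemma local_translationE:
  assumes "local_translation X Y f x"
  obtains U \<psi> V \<xi> W k where "translation_chart X (U, \<psi>)" "translation_chart Y (V, \<xi>)"
    "open W" "x \<in> W" "W \<subseteq> U" "f ` W \<subseteq> V" "\<forall>y\<in>W. \<xi> (f y) = \<psi> y + k"
  using assms unfolding local_translation_def by (elim exE conjE) (rule that)

lemma local_translationI:
  assumes "translation_chart X (U, \<psi>)" "translation_chart Y (V, \<xi>)"
    "open W" "x \<in> W" "W \<subseteq> U" "f ` W \<subseteq> V" "\<forall>y\<in>W. \<xi> (f y) = \<psi> y + k"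
  shows "local_translation X Y f x"
  unfolding local_translation_def
  by (intro exI[of _ U] exI[of _ \<psi>] exI[of _ V] exI[of _ \<xi>] exI[of _ W] exI[of _ k]) (use assms in simp)

text \<open>Only the germ at \<open>x\<close> matters. This transfers the property from a locally
  constructed flow map to \<open>flow X t\<close>.\<close>

lemma local_translation_cong:
  assumes "local_translation X Y f x" "open N" "x \<in> N" "\<And>y. y \<in> N \<Longrightarrow> g y = f y"
  shows "local_translation X Y g x"
proof -
  from assms(1) obtain U \<psi> V \<xi> W k where "translation_chart X (U, \<psi>)" "translation_chart Y (V, \<xi>)"
    "open W" "x \<in> W" "W \<subseteq> U" "f ` W \<subseteq> V" "\<forall>y\<in>W. \<xi> (f y) = \<psi> y + k"
    by (rule local_translationE) (rule that)
  then show ?thesis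
    by (intro local_translationI[of X U \<psi> Y V \<xi> "W \<inter> N" _ _ k]) (use assms(2-4) in auto)
qed

text \<open>On \<open>W\<close> the map is \<open>\<psi>\<close>, then a plane translation, then the
  inverse of \<open>\<xi>\<close>. Injectivity of \<open>\<xi>\<close> on \<open>V\<close> lets
  membership of \<open>f y\<close> in \<open>N\<close> be tested in the plane.\<close>

lemma open_preimage_translation:
  assumes c: "is_chart (U, \<psi>)" "is_chart (V, \<xi>)" and W: "open W" "W \<subseteq> U" "f ` W \<subseteq> V"
    and f: "\<forall>y\<in>W. \<xi> (f y) = \<psi> y + k" and N: "open N"
  shows "open (W \<inter> f -` N)"
proof -
  have N': "open (\<xi> ` (V \<inter> N))"
    by (rule is_chart_open_image[OF c(2)]) (use N is_chart_open(1)[OF c(2)] in auto)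
  have "open ((\<lambda>z. z + k) -` \<xi> ` (V \<inter> N))"
    by (rule open_vimage[OF N']) (intro continuous_intros)
  then have "open (W \<inter> (U \<inter> \<psi> -` (\<lambda>z. z + k) -` \<xi> ` (V \<inter> N)))"
    using W(1) is_chart_open_preimage[OF c(1)] by blast
  also have "W \<inter> (U \<inter> \<psi> -` (\<lambda>z. z + k) -` \<xi> ` (V \<inter> N)) = W \<inter> f -` N"
  proof -
    have "\<psi> y + k \<in> \<xi> ` (V \<inter> N) \<longleftrightarrow> f y \<in> N" if y: "y \<in> W" for y
    proof -
      have "\<xi> (f y) \<in> \<xi> ` (V \<inter> N) \<longleftrightarrow> f y \<in> V \<inter> N"
        using W(3) y by (intro inj_on_image_mem_iff[OF is_chart_inj[OF c(2)]]) auto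
      then show ?thesis
        using f W(3) y by auto
    qed
    then show ?thesis
      using W(2) by auto
  qed
  finally show ?thesis .
qed

lemma local_translation_compose:
  fixes Y :: "'b::{t2_space,second_countable_topology} surface_with_form"
  assumes Y: "translation_surface Y"
    and f: "local_translation X Y f x" and g: "local_translation Y Z g (f x)"
  shows "local_translation X Z (g \<circ> f) x"
proof -
  from f obtain U \<psi> V \<xi> W k where 1: "translation_chart X (U, \<psi>)" "translation_chart Y (V, \<xi>)"
    "open W" "x \<in> W" "W \<subseteq> U" "f ` W \<subseteq> V" "\<forall>y\<in>W. \<xi> (f y) = \<psi> y + k"
    by (rule local_translationE) (rule that)
  from g obtain U' \<psi>' V' \<xi>' W' k' where 2: "translation_chart Y (U', \<psi>')" "translation_chart Z (V', \<xi>')"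
    "open W'" "f x \<in> W'" "W' \<subseteq> U'" "g ` W' \<subseteq> V'" "\<forall>y\<in>W'. \<xi>' (g y) = \<psi>' y + k'"
    by (rule local_translationE) (rule that)
  \<comment> \<open>The target chart of \<open>f\<close> and the source chart of \<open>g\<close>
    are unrelated, so a third translation constant \<open>l\<close> mediates between them.\<close>
  obtain N l where N: "open N" "f x \<in> N" "N \<subseteq> V \<inter> U'" "\<forall>y\<in>N. \<psi>' y = \<xi> y + l"
  proof -
    have "f x \<in> V" "f x \<in> U'"
      using 1(4,6) 2(4,5) by auto
    from translation_chart_change[OF Y 1(2) 2(1) this] show ?thesis
      by (elim exE conjE) (rule that)
  qed
  show ?thesis
  proof (rule local_translationI[OF 1(1) 2(2)])
    show "open (W \<inter> f -` (N \<inter> W'))"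
      by (rule open_preimage_translation[OF translation_chart_chart[OF 1(1)] translation_chart_chart[OF 1(2)] 1(3,5,6,7)])
        (use N(1) 2(3) in auto)
    show "x \<in> W \<inter> f -` (N \<inter> W')" "W \<inter> f -` (N \<inter> W') \<subseteq> U"
      "(g \<circ> f) ` (W \<inter> f -` (N \<inter> W')) \<subseteq> V'"
      using 1(4,5) N(2) 2(4,6) by auto
    show "\<forall>y\<in>W \<inter> f -` (N \<inter> W'). \<xi>' ((g \<circ> f) y) = \<psi> y + (k + l + k')"
      using 1(7) 2(7) N(4) by simp
  qed
qed

context
  fixes X :: "'a::{t2_space,second_countable_topology} surface_with_form"
    and Y :: "'b::{t2_space,second_countable_topology} surface_with_form"
  assumes X: "translation_surface X" and Y: "translation_surface Y"
begin

lemma local_translation_area_locally: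
  assumes "local_translation X Y f x"
  shows "\<exists>W. open W \<and> x \<in> W \<and> inj_on f W \<and> (\<forall>B\<in>sets borel. B \<subseteq> W \<longrightarrow>
    f ` B \<in> sets borel \<and> emeasure (area_measure Y) (f ` B) = emeasure (area_measure X) B)"
proof -
  from assms obtain U \<psi> V \<xi> W k where t: "translation_chart X (U, \<psi>)" "translation_chart Y (V, \<xi>)"
    and W: "open W" "x \<in> W" "W \<subseteq> U" "f ` W \<subseteq> V" and f: "\<forall>y\<in>W. \<xi> (f y) = \<psi> y + k"
    by (rule local_translationE) (rule that)
  have c: "is_chart (U, \<psi>)" "is_chart (V, \<xi>)"
    using t by (auto intro: translation_chart_chart)
  have "inj_on f W"
  proof (rule inj_onI)
    fix y z assume yz: "y \<in> W" "z \<in> W" "f y = f z"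
    have "\<psi> y + k = \<psi> z + k"
      using bspec[OF f yz(1)] bspec[OF f yz(2)] yz(3) by simp
    then have "\<psi> y = \<psi> z"
      by simp
    then show "y = z"
      using is_chart_inj[OF c(1)] yz W(3) by (auto dest: inj_onD)
  qed
  moreover have "f ` B \<in> sets borel \<and> emeasure (area_measure Y) (f ` B) = emeasure (area_measure X) B"
    if B: "B \<in> sets borel" "B \<subseteq> W" for B
  proof -
    have \<psi>B: "\<psi> ` B \<in> sets borel"
      using is_chart_borel_image[OF c(1) B(1)] B(2) W(3) by auto
    have img: "\<xi> ` f ` B = (\<lambda>z. z + k) ` \<psi> ` B"
      unfolding image_image using f B(2) by (intro image_cong) auto
    have fB: "f ` B \<subseteq> V"
      using B(2) W(4) by auto
    have "f ` B = V \<inter> \<xi> -` \<xi> ` f ` B"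
      using fB is_chart_inj[OF c(2)] by (auto dest: inj_onD)
    then have "f ` B \<in> sets borel"
      using is_chart_borel_preimage[OF c(2) emeasure_lborel_translate(2)[OF \<psi>B]] img by simp
    moreover from this have "emeasure (area_measure Y) (f ` B) = emeasure (area_measure X) B"
      using emeasure_area_chart[OF Y t(2) _ fB] emeasure_area_chart[OF X t(1) B(1)] B(2) W(3)
      by (simp add: img emeasure_lborel_translate(1)[OF \<psi>B])
    ultimately show ?thesis
      by simp
  qed
  ultimately show ?thesis
    using W(1,2) by (intro exI[of _ W]) simp
qed

text \<open>Images of different pieces may overlap, since injectivity is only available on each
  piece. Both the area formula for injective maps and the statement on null sets are drawn from this
  partition.\<close>

lemma local_translation_partition:
  assumes B: "B \<in> sets borel" and f: "\<And>x. x \<in> B \<Longrightarrow> local_translation X Y f x"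
  shows "\<exists>C :: nat \<Rightarrow> 'a set. disjoint_family C \<and> (\<forall>i. C i \<in> sets borel) \<and> (\<Union>i. C i) = B \<and>
    (\<forall>i. f ` C i \<in> sets borel \<and> emeasure (area_measure Y) (f ` C i) = emeasure (area_measure X) (C i))"
proof -
  have "\<forall>x\<in>B. \<exists>W. open W \<and> x \<in> W \<and> (\<forall>B\<in>sets borel. B \<subseteq> W \<longrightarrow>
    f ` B \<in> sets borel \<and> emeasure (area_measure Y) (f ` B) = emeasure (area_measure X) B)"
    (is "\<forall>x\<in>B. \<exists>W. _ \<and> _ \<and> ?P W")
  proof
    fix x assume "x \<in> B"
    from local_translation_area_locally[OF f[OF this]]
    show "\<exists>W. open W \<and> x \<in> W \<and> ?P W"
      by auto
  qed
  from borel_partition_subordinate[OF B this] obtain C :: "nat \<Rightarrow> 'a set" where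
    C: "disjoint_family C" "\<forall>i. C i \<in> sets borel" "(\<Union>i. C i) = B"
    "\<forall>i. C i = {} \<or> (\<exists>W. ?P W \<and> C i \<subseteq> W)"
    by auto
  have "f ` C i \<in> sets borel \<and> emeasure (area_measure Y) (f ` C i) = emeasure (area_measure X) (C i)" for i
  proof (cases "C i = {}")
    case False
    then have "\<exists>W. ?P W \<and> C i \<subseteq> W"
      using spec[OF C(4), of i] by (simp only: simp_thms)
    then obtain W where "?P W" "C i \<subseteq> W"
      by (elim exE conjE) (rule that)
    then show ?thesis
      using C(2) by simp
  qed simp
  then show ?thesis
    using C(1-3) by (intro exI[of _ C]) simp
qed

lemma local_translation_area:
  assumes B: "B \<in> sets borel" and f: "\<And>x. x \<in> B \<Longrightarrow> local_translation X Y f x" and inj: "inj_on f B"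
  shows "emeasure (area_measure Y) (f ` B) = emeasure (area_measure X) B"
proof -
  from local_translation_partition[OF B f] obtain C :: "nat \<Rightarrow> 'a set" where
    C: "disjoint_family C" "\<forall>i. C i \<in> sets borel" "(\<Union>i. C i) = B"
    "\<forall>i. f ` C i \<in> sets borel \<and> emeasure (area_measure Y) (f ` C i) = emeasure (area_measure X) (C i)"
    by auto
  have "disjoint_family (\<lambda>i. f ` C i)"
    unfolding disjoint_family_on_def
  proof (intro ballI impI)
    fix i j :: nat assume "i \<noteq> j"
    then have "C i \<inter> C j = {}"
      using C(1) unfolding disjoint_family_on_def by simp
    moreover have "C i \<subseteq> B" "C j \<subseteq> B"
      using C(3) by auto
    ultimately show "f ` C i \<inter> f ` C j = {}"
      using inj_on_image_Int[OF inj, of "C i" "C j"] by simp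
  qed
  then have "emeasure (area_measure Y) (\<Union>i. f ` C i) = (\<Sum>i. emeasure (area_measure Y) (f ` C i))"
    by (intro suminf_emeasure[symmetric]) (use C(4) in \<open>auto simp: sets_area_measure[OF Y]\<close>)
  also have "\<dots> = (\<Sum>i. emeasure (area_measure X) (C i))"
    using C(4) by simp
  also have "\<dots> = emeasure (area_measure X) (\<Union>i. C i)"
    by (intro suminf_emeasure) (use C in \<open>auto simp: sets_area_measure[OF X]\<close>)
  finally show ?thesis
    unfolding image_UN[symmetric] C(3) .
qed

lemma local_translation_borel_image:
  assumes B: "B \<in> sets borel" and f: "\<And>x. x \<in> B \<Longrightarrow> local_translation X Y f x"
  shows "f ` B \<in> sets borel"
proof -
  from local_translation_partition[OF B f] obtain C :: "nat \<Rightarrow> 'a set" where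
    C: "(\<Union>i. C i) = B" "\<forall>i. f ` C i \<in> sets borel"
    by auto
  then show ?thesis
    unfolding C(1)[symmetric] image_UN by auto
qed

text \<open>The image is a countable union of null sets, whatever the overlaps. It is applied to the
  covering map, which is injective only sheet by sheet.\<close>

lemma local_translation_null_image:
  assumes B: "B \<in> sets borel" and f: "\<And>x. x \<in> B \<Longrightarrow> local_translation X Y f x"
    and null: "emeasure (area_measure X) B = 0"
  shows "emeasure (area_measure Y) (f ` B) = 0"
proof -
  from local_translation_partition[OF B f] obtain C :: "nat \<Rightarrow> 'a set" where
    C: "\<forall>i. C i \<in> sets borel" "(\<Union>i. C i) = B"
    "\<forall>i. f ` C i \<in> sets borel \<and> emeasure (area_measure Y) (f ` C i) = emeasure (area_measure X) (C i)"
    by auto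
  have "f ` C i \<in> null_sets (area_measure Y)" for i
  proof -
    have "emeasure (area_measure X) (C i) \<le> emeasure (area_measure X) B"
      by (rule emeasure_mono) (use C(2) B in \<open>auto simp: sets_area_measure[OF X]\<close>)
    then show ?thesis
      using C(3) null by (simp add: null_sets_def sets_area_measure[OF Y])
  qed
  then have "(\<Union>i. f ` C i) \<in> null_sets (area_measure Y)"
    by auto
  then show ?thesis
    unfolding image_UN[symmetric] C(2) by auto
qed

end

section \<open>Flow lines\<close>

text \<open>An explicit radius replaces the punctured neighbourhood filter. Taking
  \<open>r = s\<close> recovers \<open>\<gamma> s \<in> U\<close>, so that condition is
  absorbed.\<close>

lemma flow_line_iff:
  "flow_line X \<gamma> t \<longleftrightarrow> (\<forall>s\<in>closed_segment 0 t. \<exists>U \<psi> d. translation_chart X (U, \<psi>) \<and> d > 0 \<and>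
     (\<forall>r\<in>closed_segment 0 t. \<bar>r - s\<bar> < d \<longrightarrow> \<gamma> r \<in> U \<and> \<psi> (\<gamma> r) = \<psi> (\<gamma> s) + of_real (r - s)))"
  (is "_ \<longleftrightarrow> (\<forall>s\<in>?S. \<exists>U \<psi> d. ?chart U \<psi> \<and> d > 0 \<and> ?Q s U \<psi> d)")
proof -
  have "(\<exists>U \<psi>. ?chart U \<psi> \<and> \<gamma> s \<in> U \<and>
          (\<forall>\<^sub>F r in at s within ?S. \<gamma> r \<in> U \<and> \<psi> (\<gamma> r) = \<psi> (\<gamma> s) + of_real (r - s))) \<longleftrightarrow>
        (\<exists>U \<psi> d. ?chart U \<psi> \<and> d > 0 \<and> ?Q s U \<psi> d)" if s: "s \<in> ?S" for s
  proof -
    have "\<gamma> s \<in> U \<and> (\<forall>\<^sub>F r in at s within ?S. \<gamma> r \<in> U \<and> \<psi> (\<gamma> r) = \<psi> (\<gamma> s) + of_real (r - s)) \<longleftrightarrow>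
      (\<exists>d>0. ?Q s U \<psi> d)" for U \<psi>
    proof
      assume L: "\<gamma> s \<in> U \<and> (\<forall>\<^sub>F r in at s within ?S. \<gamma> r \<in> U \<and> \<psi> (\<gamma> r) = \<psi> (\<gamma> s) + of_real (r - s))"
      then obtain d where d: "d > 0"
        "\<forall>r\<in>?S. r \<noteq> s \<and> dist r s < d \<longrightarrow> \<gamma> r \<in> U \<and> \<psi> (\<gamma> r) = \<psi> (\<gamma> s) + of_real (r - s)"
        unfolding eventually_at by auto
      have "\<gamma> r \<in> U \<and> \<psi> (\<gamma> r) = \<psi> (\<gamma> s) + of_real (r - s)" if "r \<in> ?S" "\<bar>r - s\<bar> < d" for r
        using d(2) that L by (cases "r = s") (auto simp: dist_real_def)
      then show "\<exists>d>0. ?Q s U \<psi> d"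
        using d(1) by (intro exI[of _ d]) simp
    next
      assume "\<exists>d>0. ?Q s U \<psi> d"
      then obtain d where d: "d > 0" "?Q s U \<psi> d"
        by (elim exE conjE) (rule that)
      have "\<gamma> s \<in> U"
        using bspec[OF d(2) s] d(1) by simp
      moreover have "\<forall>\<^sub>F r in at s within ?S. \<gamma> r \<in> U \<and> \<psi> (\<gamma> r) = \<psi> (\<gamma> s) + of_real (r - s)"
        unfolding eventually_at using d by (intro exI[of _ d]) (auto simp: dist_real_def)
      ultimately show "\<gamma> s \<in> U \<and> (\<forall>\<^sub>F r in at s within ?S. \<gamma> r \<in> U \<and> \<psi> (\<gamma> r) = \<psi> (\<gamma> s) + of_real (r - s))"
        by simp
    qed
    then show ?thesis
      by (simp only: ex_simps)
  qed
  then show ?thesis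
    unfolding flow_line_def by (rule ball_cong[OF refl])
qed

lemma flow_lineE:
  assumes "flow_line X \<gamma> t" "s \<in> closed_segment 0 t"
  obtains U \<psi> d where "translation_chart X (U, \<psi>)" "d > 0" "\<gamma> s \<in> U"
    "\<forall>r\<in>closed_segment 0 t. \<bar>r - s\<bar> < d \<longrightarrow> \<gamma> r \<in> U \<and> \<psi> (\<gamma> r) = \<psi> (\<gamma> s) + of_real (r - s)"
proof -
  from bspec[OF assms(1)[unfolded flow_line_iff] assms(2)] obtain U \<psi> d where
    1: "translation_chart X (U, \<psi>)" "d > 0"
    "\<forall>r\<in>closed_segment 0 t. \<bar>r - s\<bar> < d \<longrightarrow> \<gamma> r \<in> U \<and> \<psi> (\<gamma> r) = \<psi> (\<gamma> s) + of_real (r - s)"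
    by (elim exE conjE) (rule that)
  moreover have "\<gamma> s \<in> U"
    using bspec[OF 1(3) assms(2)] 1(2) by simp
  ultimately show ?thesis
    by (intro that)
qed

text \<open>The duration \<open>u\<close> may have the opposite sign to \<open>t\<close>, so this
  yields both subdivision and time reversal of flow lines.\<close>

lemma flow_line_shift:
  assumes \<gamma>: "flow_line X \<gamma> t" and s: "s \<in> closed_segment 0 t" "s + u \<in> closed_segment 0 t"
  shows "flow_line X (\<lambda>v. \<gamma> (s + v)) u"
  unfolding flow_line_iff
proof
  fix v assume "v \<in> closed_segment 0 u"
  have mem: "s + w \<in> closed_segment 0 t" if "w \<in> closed_segment 0 u" for w
    using s that by (auto simp: closed_segment_eq_real_ivl split: if_splits)
  from flow_lineE[OF \<gamma> mem[OF \<open>v \<in> closed_segment 0 u\<close>]] obtain U \<psi> d where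
    1: "translation_chart X (U, \<psi>)" "d > 0"
    "\<forall>r\<in>closed_segment 0 t. \<bar>r - (s + v)\<bar> < d \<longrightarrow>
       \<gamma> r \<in> U \<and> \<psi> (\<gamma> r) = \<psi> (\<gamma> (s + v)) + of_real (r - (s + v))"
    by metis
  have "\<gamma> (s + w) \<in> U \<and> \<psi> (\<gamma> (s + w)) = \<psi> (\<gamma> (s + v)) + of_real (w - v)"
    if "w \<in> closed_segment 0 u" "\<bar>w - v\<bar> < d" for w
    using bspec[OF 1(3) mem[OF that(1)]] that(2) by (simp add: algebra_simps)
  then show "\<exists>U \<psi> d. translation_chart X (U, \<psi>) \<and> d > 0 \<and> (\<forall>w\<in>closed_segment 0 u. \<bar>w - v\<bar> < d \<longrightarrow>
      \<gamma> (s + w) \<in> U \<and> \<psi> (\<gamma> (s + w)) = \<psi> (\<gamma> (s + v)) + of_real (w - v))"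
    using 1(1,2) by (intro exI[of _ U] exI[of _ \<psi>] exI[of _ d]) simp
qed

text \<open>The graph of the time \<open>t\<close> map, usable before the definite description in
  \<open>flow\<close> is known to be well defined.\<close>

definition flow_rel :: "'a::topological_space surface_with_form \<Rightarrow> real \<Rightarrow> 'a \<Rightarrow> 'a \<Rightarrow> bool" where
  "flow_rel X t x y \<longleftrightarrow> (\<exists>\<gamma>. flow_line X \<gamma> t \<and> \<gamma> 0 = x \<and> \<gamma> t = y)"

lemma flow_rel_reverse:
  assumes "flow_rel X t x y"
  shows "flow_rel X (- t) y x"
proof -
  obtain \<gamma> where "flow_line X \<gamma> t" "\<gamma> 0 = x" "\<gamma> t = y"
    using assms unfolding flow_rel_def by blast
  then show ?thesis
    unfolding flow_rel_def using flow_line_shift[of X \<gamma> t t "- t"]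
    by (intro exI[of _ "\<lambda>v. \<gamma> (t + v)"]) simp
qed

text \<open>In a chart the line moves with unit speed, so it stays in a small ball, and injectivity
  of the chart brings this back to the surface.\<close>

lemma flow_line_continuous:
  assumes \<gamma>: "flow_line X \<gamma> t" and s: "s \<in> closed_segment 0 t" and N: "open N" "\<gamma> s \<in> N"
  shows "\<exists>d>0. \<forall>r\<in>closed_segment 0 t. \<bar>r - s\<bar> < d \<longrightarrow> \<gamma> r \<in> N"
proof -
  from flow_lineE[OF \<gamma> s] obtain U \<psi> d where
    1: "translation_chart X (U, \<psi>)" "d > 0" "\<gamma> s \<in> U"
    "\<forall>r\<in>closed_segment 0 t. \<bar>r - s\<bar> < d \<longrightarrow> \<gamma> r \<in> U \<and> \<psi> (\<gamma> r) = \<psi> (\<gamma> s) + of_real (r - s)"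
    by metis
  have c: "is_chart (U, \<psi>)"
    using translation_chart_chart[OF 1(1)] .
  have "open (\<psi> ` (U \<inter> N))"
    by (rule is_chart_open_image[OF c]) (use N(1) is_chart_open(1)[OF c] in auto)
  then obtain e where e: "e > 0" "ball (\<psi> (\<gamma> s)) e \<subseteq> \<psi> ` (U \<inter> N)"
    using 1(3) N(2) by (meson IntI imageI openE)
  have "\<gamma> r \<in> N" if r: "r \<in> closed_segment 0 t" "\<bar>r - s\<bar> < min d e" for r
  proof -
    have r': "\<gamma> r \<in> U" "\<psi> (\<gamma> r) = \<psi> (\<gamma> s) + of_real (r - s)"
      using bspec[OF 1(4) r(1)] r(2) by auto
    have "\<psi> (\<gamma> r) \<in> ball (\<psi> (\<gamma> s)) e"
      using r(2) unfolding r'(2) mem_ball dist_norm by (simp add: norm_minus_commute[of _ "of_real _"] del: of_real_diff)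
    then have "\<psi> (\<gamma> r) \<in> \<psi> ` (U \<inter> N)"
      using e(2) by auto
    then show ?thesis
      using inj_on_image_mem_iff[OF is_chart_inj[OF c] r'(1), of "U \<inter> N"] by simp
  qed
  then show ?thesis
    using 1(2) e(1) by (intro exI[of _ "min d e"]) simp
qed

context
  fixes X :: "'a::{t2_space,second_countable_topology} surface_with_form"
  assumes X: "translation_surface X"
begin

text \<open>Whether two lines agree is locally constant in time. Near a time of agreement their
  charts differ by a translation and both move with the same speed; near a time of disagreement
  Hausdorff neighbourhoods separate them. The segment is connected.\<close>

lemma flow_line_unique:
  assumes \<gamma>: "flow_line X \<gamma> t" and \<delta>: "flow_line X \<delta> t" and eq: "\<gamma> 0 = \<delta> 0" and s: "s \<in> closed_segment 0 t"
  shows "\<gamma> s = \<delta> s"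
proof (rule connected_induction_simple[where S = "closed_segment 0 t" and P = "\<lambda>s. \<gamma> s = \<delta> s" and a = 0])
  let ?S = "closed_segment 0 t"
  show "connected ?S" "0 \<in> ?S" "s \<in> ?S" "\<gamma> 0 = \<delta> 0"
    using s eq by auto
  fix u assume u: "u \<in> ?S"
  have "\<exists>d>0. \<forall>r\<in>?S. \<bar>r - u\<bar> < d \<longrightarrow> (\<gamma> r = \<delta> r \<longleftrightarrow> \<gamma> u = \<delta> u)"
  proof (cases "\<gamma> u = \<delta> u")
    case True
    from flow_lineE[OF \<gamma> u] obtain U \<psi> d where
      1: "translation_chart X (U, \<psi>)" "d > 0" "\<gamma> u \<in> U"
      "\<forall>r\<in>?S. \<bar>r - u\<bar> < d \<longrightarrow> \<gamma> r \<in> U \<and> \<psi> (\<gamma> r) = \<psi> (\<gamma> u) + of_real (r - u)"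
      by metis
    from flow_lineE[OF \<delta> u] obtain V \<xi> e where
      2: "translation_chart X (V, \<xi>)" "e > 0" "\<delta> u \<in> V"
      "\<forall>r\<in>?S. \<bar>r - u\<bar> < e \<longrightarrow> \<delta> r \<in> V \<and> \<xi> (\<delta> r) = \<xi> (\<delta> u) + of_real (r - u)"
      by metis
    obtain W k where W: "open W" "\<gamma> u \<in> W" "W \<subseteq> U \<inter> V" "\<forall>y\<in>W. \<xi> y = \<psi> y + k"
      using translation_chart_change[OF X 1(1) 2(1) 1(3)] 2(3) True by auto
    obtain d' where d': "d' > 0" "\<forall>r\<in>?S. \<bar>r - u\<bar> < d' \<longrightarrow> \<delta> r \<in> W"
      using flow_line_continuous[OF \<delta> u W(1)] W(2) True by auto
    have "\<gamma> r = \<delta> r" if r: "r \<in> ?S" "\<bar>r - u\<bar> < min (min d e) d'" for r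
    proof -
      have "\<delta> r \<in> W" "\<gamma> r \<in> U"
        using d'(2) 1(4) r by auto
      have "\<psi> (\<delta> r) + k = \<xi> (\<delta> r)"
        using W(4) \<open>\<delta> r \<in> W\<close> by simp
      also have "\<dots> = \<xi> (\<gamma> u) + of_real (r - u)"
        using bspec[OF 2(4) r(1)] r(2) True by simp
      also have "\<dots> = \<psi> (\<gamma> u) + of_real (r - u) + k"
        using bspec[OF W(4) W(2)] by simp
      also have "\<dots> = \<psi> (\<gamma> r) + k"
        using bspec[OF 1(4) r(1)] r(2) by simp
      finally have "\<psi> (\<gamma> r) = \<psi> (\<delta> r)"
        by simp
      then show ?thesis
        using is_chart_inj[OF translation_chart_chart[OF 1(1)]] \<open>\<delta> r \<in> W\<close> \<open>\<gamma> r \<in> U\<close> W(3)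
        by (auto dest: inj_onD)
    qed
    then show ?thesis
      using True 1(2) 2(2) d'(1) by (intro exI[of _ "min (min d e) d'"]) simp
  next
    case False
    then obtain N M where NM: "open N" "open M" "\<gamma> u \<in> N" "\<delta> u \<in> M" "N \<inter> M = {}"
      using hausdorff by metis
    obtain d where d: "d > 0" "\<forall>r\<in>?S. \<bar>r - u\<bar> < d \<longrightarrow> \<gamma> r \<in> N"
      using flow_line_continuous[OF \<gamma> u NM(1,3)] by auto
    obtain e where e: "e > 0" "\<forall>r\<in>?S. \<bar>r - u\<bar> < e \<longrightarrow> \<delta> r \<in> M"
      using flow_line_continuous[OF \<delta> u NM(2,4)] by auto
    have "\<gamma> r \<noteq> \<delta> r" if "r \<in> ?S" "\<bar>r - u\<bar> < min d e" for r
      using d(2) e(2) NM(5) that by force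
    then show ?thesis
      using False d(1) e(1) by (intro exI[of _ "min d e"]) simp
  qed
  then obtain d where d: "d > 0" "\<forall>r\<in>?S. \<bar>r - u\<bar> < d \<longrightarrow> (\<gamma> r = \<delta> r \<longleftrightarrow> \<gamma> u = \<delta> u)"
    by (elim exE conjE) (rule that)
  show "\<exists>T. openin (top_of_set ?S) T \<and> u \<in> T \<and> (\<forall>x\<in>T. \<forall>y\<in>T. \<gamma> x = \<delta> x \<longrightarrow> \<gamma> y = \<delta> y)"
  proof (intro exI conjI ballI impI)
    show "openin (top_of_set ?S) (?S \<inter> ball u d)"
      by (intro openin_open_Int open_ball)
    show "u \<in> ?S \<inter> ball u d"
      using u d(1) by simp
    fix x y assume "x \<in> ?S \<inter> ball u d" "y \<in> ?S \<inter> ball u d" "\<gamma> x = \<delta> x"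
    then show "\<gamma> y = \<delta> y"
      using d(2) by (auto simp: dist_real_def abs_minus_commute)
  qed
qed

lemma flow_rel_unique: "flow_rel X t x y \<Longrightarrow> flow_rel X t x z \<Longrightarrow> y = z"
  unfolding flow_rel_def using flow_line_unique by (metis ends_in_segment(2))

lemma flow_rel_imp_flow:
  assumes "flow_rel X t x y"
  shows "x \<in> flow_domain X t" "flow X t x = y"
proof -
  show "x \<in> flow_domain X t"
    using assms unfolding flow_rel_def flow_domain_def by auto
  have "flow X t x = (THE y. flow_rel X t x y)"
    unfolding flow_def flow_rel_def ..
  then show "flow X t x = y"
    using assms flow_rel_unique by (auto intro: the_equality)
qed

lemma flow_domain_imp_flow_rel:
  assumes "x \<in> flow_domain X t"
  shows "flow_rel X t x (flow X t x)"
proof -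
  obtain y where "flow_rel X t x y"
    using assms unfolding flow_rel_def flow_domain_def by auto
  then show ?thesis
    using flow_rel_imp_flow(2) by simp
qed

text \<open>The condition \<open>0 \<le> s * t\<close> says that both motions have the same
  direction, so their time segments overlap only at \<open>s\<close> and the lines can be
  concatenated.\<close>

lemma flow_rel_trans:
  assumes xy: "flow_rel X s x y" and yz: "flow_rel X t y z" and st: "0 \<le> s * t"
  shows "flow_rel X (s + t) x z"
proof -
  obtain \<gamma> where \<gamma>: "flow_line X \<gamma> s" "\<gamma> 0 = x" "\<gamma> s = y"
    using xy unfolding flow_rel_def by blast
  obtain \<delta> where \<delta>: "flow_line X \<delta> t" "\<delta> 0 = y" "\<delta> t = z"
    using yz unfolding flow_rel_def by blast
  have sign: "0 \<le> s \<and> 0 \<le> t \<or> s \<le> 0 \<and> t \<le> 0"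
    using st by (simp add: zero_le_mult_iff)
  let ?A = "closed_segment 0 s" and ?B = "closed_segment 0 t" and ?S = "closed_segment 0 (s + t)"
  define \<eta> where "\<eta> u = (if u \<in> ?A then \<gamma> u else \<delta> (u - s))" for u
  have split: "r \<in> ?A \<or> r - s \<in> ?B" if "r \<in> ?S" for r
    using that sign by (auto simp: closed_segment_eq_real_ivl split: if_splits)
  have \<eta>B: "\<eta> u = \<delta> (u - s)" if "u - s \<in> ?B" for u
  proof (cases "u \<in> ?A")
    case True
    then have "u = s"
      using that sign by (auto simp: closed_segment_eq_real_ivl split: if_splits)
    then show ?thesis
      unfolding \<eta>_def using \<gamma>(3) \<delta>(2) by simp
  qed (simp add: \<eta>_def)
  have \<eta>A: "\<eta> u = \<gamma> u" if "u \<in> ?A" for u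
    using that by (simp add: \<eta>_def)
  have "flow_line X \<eta> (s + t)"
    unfolding flow_line_iff
  proof
    fix u assume u: "u \<in> ?S"
    \<comment> \<open>Away from the junction time \<open>s\<close>, a radius of at most the distance
      from \<open>u\<close> to \<open>s\<close> keeps \<open>r\<close> on one of the two lines. Only
      at the junction must a chart of one line be compared with a chart of the other.\<close>
    consider "u \<in> ?A" "u \<noteq> s" | "u = s" | "u \<notin> ?A" "u - s \<in> ?B"
      using split[OF u] by blast
    then show "\<exists>U \<psi> d. translation_chart X (U, \<psi>) \<and> d > 0 \<and> (\<forall>r\<in>?S. \<bar>r - u\<bar> < d \<longrightarrow>
      \<eta> r \<in> U \<and> \<psi> (\<eta> r) = \<psi> (\<eta> u) + of_real (r - u))"
    proof cases
      case 1
      from flow_lineE[OF \<gamma>(1) 1(1)] obtain U \<psi> d where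
        c: "translation_chart X (U, \<psi>)" "d > 0"
        "\<forall>r\<in>?A. \<bar>r - u\<bar> < d \<longrightarrow> \<gamma> r \<in> U \<and> \<psi> (\<gamma> r) = \<psi> (\<gamma> u) + of_real (r - u)"
        by metis
      have "\<eta> r \<in> U \<and> \<psi> (\<eta> r) = \<psi> (\<eta> u) + of_real (r - u)"
        if r: "r \<in> ?S" "\<bar>r - u\<bar> < min d \<bar>u - s\<bar>" for r
      proof -
        have "r \<in> ?A"
          using r 1 sign by (auto simp: closed_segment_eq_real_ivl abs_if split: if_splits)
        then show ?thesis
          using c(3) r(2) by (simp add: \<eta>A 1(1))
      qed
      then show ?thesis
        using c(1,2) 1(2) by (intro exI[of _ U] exI[of _ \<psi>] exI[of _ "min d \<bar>u - s\<bar>"]) simp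
    next
      case 2
      have sA: "s \<in> ?A" and tB: "0 \<in> ?B"
        by auto
      from flow_lineE[OF \<gamma>(1) sA] obtain U \<psi> d where
        c: "translation_chart X (U, \<psi>)" "d > 0" "\<gamma> s \<in> U"
        "\<forall>r\<in>?A. \<bar>r - s\<bar> < d \<longrightarrow> \<gamma> r \<in> U \<and> \<psi> (\<gamma> r) = \<psi> (\<gamma> s) + of_real (r - s)"
        by metis
      from flow_lineE[OF \<delta>(1) tB] obtain V \<xi> e where
        c': "translation_chart X (V, \<xi>)" "e > 0" "\<delta> 0 \<in> V"
        "\<forall>r\<in>?B. \<bar>r - 0\<bar> < e \<longrightarrow> \<delta> r \<in> V \<and> \<xi> (\<delta> r) = \<xi> (\<delta> 0) + of_real (r - 0)"
        by metis
      obtain W k where W: "open W" "y \<in> W" "W \<subseteq> U \<inter> V" "\<forall>w\<in>W. \<xi> w = \<psi> w + k"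
        using translation_chart_change[OF X c(1) c'(1), of y] c(3) c'(3) \<gamma>(3) \<delta>(2) by auto
      obtain d' where d': "d' > 0" "\<forall>r\<in>?B. \<bar>r - 0\<bar> < d' \<longrightarrow> \<delta> r \<in> W"
        using flow_line_continuous[OF \<delta>(1) tB W(1)] W(2) \<delta>(2) by auto
      have "\<eta> r \<in> U \<and> \<psi> (\<eta> r) = \<psi> (\<eta> u) + of_real (r - u)"
        if r: "r \<in> ?S" "\<bar>r - u\<bar> < min (min d e) d'" for r
      proof (cases "r \<in> ?A")
        case True
        then show ?thesis
          using c(4) r(2) 2 by (simp add: \<eta>A)
      next
        case False
        then have rB: "r - s \<in> ?B"
          using split[OF r(1)] by simp
        have w: "\<delta> (r - s) \<in> W"
          using bspec[OF d'(2) rB] r(2) 2 by simp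
        have "\<psi> (\<delta> (r - s)) + k = \<xi> (\<delta> (r - s))"
          using W(4) w by simp
        also have "\<dots> = \<xi> y + of_real (r - s)"
          using bspec[OF c'(4) rB] r(2) 2 \<delta>(2) by simp
        also have "\<dots> = \<psi> y + of_real (r - s) + k"
          using W(2,4) by simp
        finally have "\<psi> (\<delta> (r - s)) = \<psi> y + of_real (r - s)"
          by simp
        then show ?thesis
          using w W(3) 2 \<gamma>(3) by (auto simp: \<eta>A \<eta>B[OF rB])
      qed
      then show ?thesis
        using c(1,2) c'(2) d'(1) by (intro exI[of _ U] exI[of _ \<psi>] exI[of _ "min (min d e) d'"]) simp
    next
      case 3
      from flow_lineE[OF \<delta>(1) 3(2)] obtain U \<psi> d where
        c: "translation_chart X (U, \<psi>)" "d > 0"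
        "\<forall>r\<in>?B. \<bar>r - (u - s)\<bar> < d \<longrightarrow> \<delta> r \<in> U \<and> \<psi> (\<delta> r) = \<psi> (\<delta> (u - s)) + of_real (r - (u - s))"
        by metis
      have us: "u \<noteq> s"
        using 3(1) by auto
      have "\<eta> r \<in> U \<and> \<psi> (\<eta> r) = \<psi> (\<eta> u) + of_real (r - u)"
        if r: "r \<in> ?S" "\<bar>r - u\<bar> < min d \<bar>u - s\<bar>" for r
      proof -
        have rB: "r - s \<in> ?B"
          using r 3 sign by (auto simp: closed_segment_eq_real_ivl abs_if split: if_splits)
        show ?thesis
          using bspec[OF c(3) rB] r(2) by (simp add: \<eta>B[OF rB] \<eta>B[OF 3(2)])
      qed
      then show ?thesis
        using c(1,2) us by (intro exI[of _ U] exI[of _ \<psi>] exI[of _ "min d \<bar>u - s\<bar>"]) simp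
    qed
  qed
  moreover have "\<eta> 0 = x" "\<eta> (s + t) = z"
    using \<eta>A[of 0] \<eta>B[of "s + t"] \<gamma>(2) \<delta>(3) by auto
  ultimately show ?thesis
    unfolding flow_rel_def by blast
qed

end

section \<open>The time-\<open>t\<close> maps\<close>

lemma local_translation_open_preimage:
  assumes f: "local_translation X Y f x" and N: "open N" "f x \<in> N"
  shows "\<exists>W. open W \<and> x \<in> W \<and> f ` W \<subseteq> N"
proof -
  from f obtain U \<psi> V \<xi> W k where 1: "translation_chart X (U, \<psi>)" "translation_chart Y (V, \<xi>)"
    "open W" "x \<in> W" "W \<subseteq> U" "f ` W \<subseteq> V" "\<forall>y\<in>W. \<xi> (f y) = \<psi> y + k"
    by (rule local_translationE) (rule that)
  have "open (W \<inter> f -` N)"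
    using open_preimage_translation[OF translation_chart_chart[OF 1(1)] translation_chart_chart[OF 1(2)] 1(3,5,6,7) N(1)] .
  then show ?thesis
    using 1(4) N(2) by (intro exI[of _ "W \<inter> f -` N"]) auto
qed

text \<open>The germ of a time \<open>t\<close> map at \<open>x\<close>. An arbitrary
  \<open>g\<close> in place of \<open>flow X t\<close> lets germs be composed as functions.\<close>

definition local_flow_at :: "'a::topological_space surface_with_form \<Rightarrow> real \<Rightarrow> 'a \<Rightarrow> bool" where
  "local_flow_at X t x \<longleftrightarrow> (\<exists>W g. open W \<and> x \<in> W \<and> (\<forall>z\<in>W. flow_rel X t z (g z)) \<and> local_translation X X g x)"

context
  fixes X :: "'a::{t2_space,second_countable_topology} surface_with_form"
  assumes X: "translation_surface X"
begin

lemma local_flow_small_time: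
  assumes x: "x \<notin> zeros X"
  shows "\<exists>N e. open N \<and> x \<in> N \<and> e > 0 \<and> (\<forall>y\<in>N. \<forall>r. \<bar>r\<bar> < e \<longrightarrow> local_flow_at X r y)"
proof -
  obtain U \<psi> where U: "translation_chart X (U, \<psi>)" "x \<in> U"
    using translation_chart_exists[OF X x] by blast
  have c: "is_chart (U, \<psi>)"
    using translation_chart_chart[OF U(1)] .
  obtain e' where e': "e' > 0" "ball (\<psi> x) e' \<subseteq> \<psi> ` U"
    using is_chart_open(2)[OF c] U(2) by (meson imageI openE)
  \<comment> \<open>A point of \<open>N\<close> lies within \<open>e\<close> of the centre and moves
    by less than \<open>e\<close>, so it stays in the ball of radius \<open>2 * e\<close>.\<close>
  define e where "e = e' / 2"
  have e: "e > 0" "ball (\<psi> x) (2 * e) \<subseteq> \<psi> ` U"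
    using e' by (auto simp: e_def)
  define N where "N = U \<inter> \<psi> -` ball (\<psi> x) e"
  have N: "open N" "x \<in> N" "N \<subseteq> U"
    using is_chart_open_preimage[OF c open_ball] U(2) e(1) by (auto simp: N_def)
  have near: "\<psi> z + of_real u \<in> \<psi> ` U" if "z \<in> N" "\<bar>u\<bar> < e" for z u
  proof -
    have "dist (\<psi> x) (\<psi> z + of_real u) \<le> dist (\<psi> x) (\<psi> z) + dist (\<psi> z) (\<psi> z + of_real u)"
      by (rule dist_triangle)
    also have "\<dots> < 2 * e"
      using that by (simp add: N_def dist_norm)
    finally show ?thesis
      using e(2) by auto
  qed
  have "local_flow_at X r y" if y: "y \<in> N" and r: "\<bar>r\<bar> < e" for y r
  proof -
    define h where "h z u = inv_into U \<psi> (\<psi> z + complex_of_real u)" for z u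
    have hU: "h z u \<in> U" and h: "\<psi> (h z u) = \<psi> z + of_real u" if "z \<in> N" "\<bar>u\<bar> < e" for z u
      using near[OF that] by (simp_all add: h_def inv_into_into f_inv_into_f)
    have "flow_rel X r z (h z r)" if z: "z \<in> N" for z
      unfolding flow_rel_def
    proof (intro exI conjI)
      have small: "\<bar>u\<bar> < e" if "u \<in> closed_segment 0 r" for u
        using that r by (auto simp: closed_segment_eq_real_ivl split: if_splits)
      show "flow_line X (h z) r"
        unfolding flow_line_iff
      proof
        \<comment> \<open>The whole line stays in one chart, so any positive radius works; 1 is
          chosen.\<close>
        fix s assume s: "s \<in> closed_segment 0 r"
        show "\<exists>U \<psi> d. translation_chart X (U, \<psi>) \<and> d > 0 \<and> (\<forall>r'\<in>closed_segment 0 r. \<bar>r' - s\<bar> < d \<longrightarrow>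
          h z r' \<in> U \<and> \<psi> (h z r') = \<psi> (h z s) + of_real (r' - s))"
          by (intro exI[of _ U] exI[of _ \<psi>] exI[of _ 1])
            (use U(1) hU[OF z small] h[OF z small] s in auto)
      qed
      show "h z 0 = z"
        using z N(3) is_chart_inj[OF c] by (auto simp: h_def inv_into_f_f)
    qed simp
    moreover have "local_translation X X (\<lambda>z. h z r) y"
      by (rule local_translationI[OF U(1) U(1) N(1) y N(3)]) (use hU h r in auto)
    ultimately show ?thesis
      unfolding local_flow_at_def using N(1) y by (intro exI[of _ N] exI[of _ "\<lambda>z. h z r"]) simp
  qed
  then show ?thesis
    using N(1,2) e(1) by (intro exI[of _ N] exI[of _ e]) simp
qed

lemma local_flow_at_compose:
  assumes 1: "local_flow_at X s x" and xy: "flow_rel X s x y" and 2: "local_flow_at X t y" and st: "0 \<le> s * t"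
  shows "local_flow_at X (s + t) x"
proof -
  from 1 obtain W g where g: "open W" "x \<in> W" "\<forall>z\<in>W. flow_rel X s z (g z)" "local_translation X X g x"
    unfolding local_flow_at_def by (elim exE conjE) (rule that)
  from 2 obtain W' g' where g': "open W'" "y \<in> W'" "\<forall>z\<in>W'. flow_rel X t z (g' z)" "local_translation X X g' y"
    unfolding local_flow_at_def by (elim exE conjE) (rule that)
  have gx: "g x = y"
    using flow_rel_unique[OF X _ xy] g(2,3) by simp
  then obtain W'' where W'': "open W''" "x \<in> W''" "g ` W'' \<subseteq> W'"
    using local_translation_open_preimage[OF g(4) g'(1)] g'(2) by auto
  show ?thesis
    unfolding local_flow_at_def
  proof (intro exI[of _ "W \<inter> W''"] exI[of _ "g' \<circ> g"] conjI ballI)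
    show "open (W \<inter> W'')" "x \<in> W \<inter> W''"
      using g(1,2) W''(1,2) by auto
    show "local_translation X X (g' \<circ> g) x"
      using local_translation_compose[OF X g(4)] g'(4) gx by simp
    fix z assume z: "z \<in> W \<inter> W''"
    have "flow_rel X s z (g z)" "flow_rel X t (g z) (g' (g z))"
      using g(3) g'(3) W''(3) z by auto
    then show "flow_rel X (s + t) z ((g' \<circ> g) z)"
      using flow_rel_trans[OF X _ _ st] by simp
  qed
qed

text \<open>Flow boxes along the compact line are composed into one. Bolzano bisection takes the
  place of choosing a finite subcover.\<close>

lemma flow_rel_imp_local_flow_at:
  assumes "flow_rel X t x y"
  shows "local_flow_at X t x"
proof -
  obtain \<gamma> where \<gamma>: "flow_line X \<gamma> t" "\<gamma> 0 = x"
    using assms unfolding flow_rel_def by blast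
  have seg: "u * t \<in> closed_segment 0 t" if "0 \<le> u" "u \<le> 1" for u
    using that unfolding closed_segment_def by auto
  \<comment> \<open>Rescaling time to the unit interval treats both signs of \<open>t\<close> at
    once. \<open>P a b\<close> says that the stretch of the line from time \<open>a * t\<close> to
    time \<open>b * t\<close> extends to a neighbourhood of its start.\<close>
  define P where "P a b \<longleftrightarrow> (0 \<le> a \<and> a \<le> b \<and> b \<le> 1 \<longrightarrow> local_flow_at X ((b - a) * t) (\<gamma> (a * t)))" for a b
  have "P 0 1"
  proof (rule Bolzano)
    fix a b c assume ab: "P a b" and bc: "P b c" and ord: "a \<le> b" "b \<le> c"
    show "P a c"
      unfolding P_def
    proof
      assume ac: "0 \<le> a \<and> a \<le> c \<and> c \<le> 1"
      have "flow_line X (\<lambda>v. \<gamma> (a * t + v)) ((b - a) * t)"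
        by (rule flow_line_shift[OF \<gamma>(1)]) (use seg[of a] seg[of b] ac ord in \<open>auto simp: algebra_simps\<close>)
      then have "flow_rel X ((b - a) * t) (\<gamma> (a * t)) (\<gamma> (b * t))"
        unfolding flow_rel_def by (intro exI[of _ "\<lambda>v. \<gamma> (a * t + v)"]) (simp add: algebra_simps)
      moreover have "0 \<le> (b - a) * t * ((c - b) * t)"
      proof -
        have eq: "(b - a) * t * ((c - b) * t) = (b - a) * (c - b) * (t * t)"
          by simp
        show ?thesis
          unfolding eq using ord by (intro mult_nonneg_nonneg[OF mult_nonneg_nonneg zero_le_square]) auto
      qed
      ultimately have "local_flow_at X ((b - a) * t + (c - b) * t) (\<gamma> (a * t))"
        using ab bc ac ord unfolding P_def by (intro local_flow_at_compose) auto
      then show "local_flow_at X ((c - a) * t) (\<gamma> (a * t))"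
        by (simp add: algebra_simps)
    qed
  next
    fix u :: real assume u: "0 \<le> u" "u \<le> 1"
    have "\<gamma> (u * t) \<notin> zeros X"
      using flow_lineE[OF \<gamma>(1) seg[OF u]] unfolding translation_chart_def by (metis IntI empty_iff fst_conv)
    then obtain N e where N: "open N" "\<gamma> (u * t) \<in> N" "e > 0" "\<forall>y\<in>N. \<forall>r. \<bar>r\<bar> < e \<longrightarrow> local_flow_at X r y"
      using local_flow_small_time by metis
    obtain d where d: "d > 0" "\<forall>r\<in>closed_segment 0 t. \<bar>r - u * t\<bar> < d \<longrightarrow> \<gamma> r \<in> N"
      using flow_line_continuous[OF \<gamma>(1) seg[OF u] N(1,2)] by auto
    \<comment> \<open>Parameters closer than \<open>m\<close> correspond to times closer than
      \<open>min d e\<close>. Adding 1 keeps the divisor positive when \<open>t = 0\<close>.\<close>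
    define m where "m = min d e / (\<bar>t\<bar> + 1)"
    have m: "m > 0"
      using N(3) d(1) by (simp add: m_def)
    have "P a b" if ab: "a \<le> u \<and> u \<le> b \<and> b - a < m" for a b
      unfolding P_def
    proof
      assume ab': "0 \<le> a \<and> a \<le> b \<and> b \<le> 1"
      have "(b - a) * \<bar>t\<bar> \<le> (b - a) * (\<bar>t\<bar> + 1)"
        using ab' by (intro mult_left_mono) auto
      also have "\<dots> < m * (\<bar>t\<bar> + 1)"
        using ab by (intro mult_strict_right_mono) auto
      also have "\<dots> = min d e"
        by (simp add: m_def)
      finally have small: "(b - a) * \<bar>t\<bar> < min d e" .
      have "\<bar>a * t - u * t\<bar> = (u - a) * \<bar>t\<bar>"
        using ab by (simp add: left_diff_distrib[symmetric] abs_mult)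
      also have "\<dots> \<le> (b - a) * \<bar>t\<bar>"
        using ab by (intro mult_right_mono) auto
      finally have "\<gamma> (a * t) \<in> N"
        using d(2) seg[of a] small ab ab' u by auto
      moreover have "\<bar>(b - a) * t\<bar> < e"
        using small ab' by (simp add: abs_mult)
      ultimately show "local_flow_at X ((b - a) * t) (\<gamma> (a * t))"
        using N(4) by blast
    qed
    then show "\<exists>d>0. \<forall>a b. a \<le> u \<and> u \<le> b \<and> b - a < d \<longrightarrow> P a b"
      using m by (intro exI[of _ m]) simp
  qed simp
  then show ?thesis
    by (simp add: P_def \<gamma>(2))
qed

lemma flow_domain_locally:
  assumes "x \<in> flow_domain X t"
  shows "local_translation X X (flow X t) x" "\<exists>W. open W \<and> x \<in> W \<and> W \<subseteq> flow_domain X t"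
proof -
  obtain W g where g: "open W" "x \<in> W" "\<forall>z\<in>W. flow_rel X t z (g z)" "local_translation X X g x"
    using flow_rel_imp_local_flow_at[OF flow_domain_imp_flow_rel[OF X assms]]
    unfolding local_flow_at_def by (elim exE conjE) (rule that)
  then show "\<exists>W. open W \<and> x \<in> W \<and> W \<subseteq> flow_domain X t"
    using flow_rel_imp_flow(1)[OF X] by (intro exI[of _ W]) blast
  show "local_translation X X (flow X t) x"
    by (rule local_translation_cong[OF g(4,1,2)]) (use g(3) flow_rel_imp_flow(2)[OF X] in blast)
qed

section \<open>Time \<open>t\<close> maps as partial area-preserving bijections\<close>

lemma flow_domain_borel: "flow_domain X t \<in> sets borel"
proof -
  have "open (flow_domain X t)"
    by (rule Topological_Spaces.openI) (rule flow_domain_locally(2))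
  then show ?thesis
    by simp
qed

lemma flow_uminus:
  assumes "x \<in> flow_domain X t"
  shows "flow X t x \<in> flow_domain X (- t)" "flow X (- t) (flow X t x) = x"
  using flow_rel_imp_flow[OF X flow_rel_reverse[OF flow_domain_imp_flow_rel[OF X assms]]] by auto

lemma inj_on_flow: "inj_on (flow X t) (flow_domain X t)"
  using flow_uminus(2) by (rule inj_on_inverseI)

text \<open>The time \<open>-t\<close> map inverts the time \<open>t\<close> map. In this form the
  results on images under injective local translations apply to preimages.\<close>

lemma flow_preimage_eq: "flow_preimage X t B = flow X (- t) ` (B \<inter> flow_domain X (- t))"
proof (intro equalityI subsetI)
  fix x assume "x \<in> flow_preimage X t B"
  then have "x \<in> flow_domain X t" "flow X t x \<in> B"
    unfolding flow_preimage_def by auto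
  then show "x \<in> flow X (- t) ` (B \<inter> flow_domain X (- t))"
    using flow_uminus[of x t] by (intro image_eqI[of _ _ "flow X t x"]) auto
next
  fix x assume "x \<in> flow X (- t) ` (B \<inter> flow_domain X (- t))"
  then obtain y where "y \<in> B" "y \<in> flow_domain X (- t)" "x = flow X (- t) y"
    by blast
  then show "x \<in> flow_preimage X t B"
    using flow_uminus[of y "- t"] unfolding flow_preimage_def by simp
qed

lemma flow_preimage_borel:
  assumes "B \<in> sets borel"
  shows "flow_preimage X t B \<in> sets borel"
  unfolding flow_preimage_eq
  by (rule local_translation_borel_image[OF X X]) (use assms flow_domain_borel flow_domain_locally(1) in auto)

lemma emeasure_area_flow_preimage:
  assumes "B \<in> sets borel"
  shows "emeasure (area_measure X) (flow_preimage X t B) = emeasure (area_measure X) (B \<inter> flow_domain X (- t))"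
  unfolding flow_preimage_eq
  by (rule local_translation_area[OF X X])
    (use assms flow_domain_borel flow_domain_locally(1) inj_on_subset[OF inj_on_flow] in auto)

lemma sets_lebesgue_prob: "sets (lebesgue_prob X) = sets borel"
  using sets_area_measure[OF X] by (simp add: lebesgue_prob_def)

lemma space_lebesgue_prob: "space (lebesgue_prob X) = UNIV"
  using sets_eq_imp_space_eq[OF sets_lebesgue_prob] by simp

text \<open>The preimage only accounts for the points of \<open>B\<close> that can be flowed back,
  and almost every point can: the hypothesis is applied at time \<open>-t\<close>.\<close>

lemma flow_invariant_lebesgue_prob:
  assumes "flow_defined_ae X"
  shows "flow_invariant X (lebesgue_prob X)"
  unfolding flow_invariant_def
proof (intro allI ballI)
  fix t and B :: "'a set" assume B: "B \<in> sets borel"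
  have "AE x in lebesgue_prob X. x \<in> flow_domain X (- t)"
    using assms unfolding flow_defined_ae_def by blast
  then have "AE x in lebesgue_prob X. x \<in> B \<inter> flow_domain X (- t) \<longleftrightarrow> x \<in> B"
    by eventually_elim simp
  then have "emeasure (lebesgue_prob X) (B \<inter> flow_domain X (- t)) = emeasure (lebesgue_prob X) B"
    by (rule emeasure_eq_AE) (use B flow_domain_borel in \<open>auto simp: sets_lebesgue_prob\<close>)
  then show "emeasure (lebesgue_prob X) (flow_preimage X t B) = emeasure (lebesgue_prob X) B"
    using emeasure_area_flow_preimage[OF B] by (simp add: lebesgue_prob_def)
qed

end

section \<open>Finite covers\<close>

lemma evenly_covered:
  assumes "covering_space UNIV p UNIV"
  obtains T v where "x \<in> T" "open T" "\<Union>v = p -` T" "\<And>u. u \<in> v \<Longrightarrow> open u" "pairwise disjnt v"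
    "\<And>u. u \<in> v \<Longrightarrow> \<exists>q. homeomorphism u T p q"
proof -
  have "\<forall>x\<in>UNIV. \<exists>T. x \<in> T \<and> openin (top_of_set UNIV) T \<and>
    (\<exists>v. \<Union>v = UNIV \<inter> p -` T \<and> (\<forall>u\<in>v. openin (top_of_set UNIV) u) \<and>
      pairwise disjnt v \<and> (\<forall>u\<in>v. \<exists>q. homeomorphism u T p q))"
    using assms unfolding covering_space_def by (elim conjE)
  from bspec[OF this UNIV_I[of x]] obtain T v where
    1: "x \<in> T" "openin (top_of_set UNIV) T" "\<Union>v = UNIV \<inter> p -` T"
    "\<forall>u\<in>v. openin (top_of_set UNIV) u" "pairwise disjnt v" "\<forall>u\<in>v. \<exists>q. homeomorphism u T p q"
    by (elim exE conjE) (rule that)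
  show ?thesis
    by (rule that[of T v]) (use 1 in auto)
qed

lemma bij_betw_sheets_fibre:
  assumes T: "\<Union>v = p -` T" "pairwise disjnt v" "\<And>u. u \<in> v \<Longrightarrow> \<exists>q. homeomorphism u T p q" and x: "x \<in> T"
  shows "bij_betw (\<lambda>u. inv_into u p x) v (p -` {x})"
proof -
  have img: "p ` u = T" and inj: "inj_on p u" if "u \<in> v" for u
    using T(3)[OF that] unfolding homeomorphism_def by (auto intro: inj_on_inverseI)
  have mem: "inv_into u p x \<in> u" "p (inv_into u p x) = x" if "u \<in> v" for u
    using img[OF that] x by (auto simp: inv_into_into f_inv_into_f)
  show "bij_betw (\<lambda>u. inv_into u p x) v (p -` {x})"
    unfolding bij_betw_def
  proof
    show "inj_on (\<lambda>u. inv_into u p x) v"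
    proof (rule inj_onI, rule ccontr)
      fix u u' assume u: "u \<in> v" "u' \<in> v" "inv_into u p x = inv_into u' p x" "u \<noteq> u'"
      then have "disjnt u u'"
        using T(2) by (auto dest: pairwiseD)
      then show False
        using mem(1)[OF u(1)] mem(1)[OF u(2)] u(3) by (auto simp: disjnt_iff)
    qed
    show "(\<lambda>u. inv_into u p x) ` v = p -` {x}"
    proof (intro equalityI subsetI)
      fix y assume y: "y \<in> p -` {x}"
      then have "y \<in> \<Union>v"
        using T(1) x by auto
      then obtain u where "u \<in> v" "y \<in> u"
        by blast
      then show "y \<in> (\<lambda>u. inv_into u p x) ` v"
        using y inj by (intro image_eqI[of _ _ u]) auto
    qed (use mem(2) in auto)
  qed
qed

text \<open>Over an evenly covered set every fibre has as many points as there are sheets, so the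
  cardinality is locally constant on a connected base.\<close>

lemma card_fibre_constant:
  fixes p :: "'b::topological_space \<Rightarrow> 'a::topological_space"
  assumes p: "covering_space UNIV p UNIV" and conn: "connected (UNIV :: 'a set)"
  shows "\<exists>n. \<forall>x. card (p -` {x}) = n"
proof -
  have "(\<lambda>x. card (p -` {x})) constant_on (UNIV :: 'a set)"
  proof (rule locally_constant_imp_constant[OF conn])
    fix a :: 'a
    obtain T v where T: "a \<in> T" "open T" "\<Union>v = p -` T" "pairwise disjnt v"
      "\<And>u. u \<in> v \<Longrightarrow> \<exists>q. homeomorphism u T p q"
      using evenly_covered[OF p] by metis
    have "card (p -` {x}) = card v" if x: "x \<in> T" for x
      using bij_betw_same_card[OF bij_betw_sheets_fibre[OF T(3,4,5) x]] by simp
    then show "\<exists>T. openin (top_of_set UNIV) T \<and> a \<in> T \<and> (\<forall>x\<in>T. card (p -` {x}) = card (p -` {a}))"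
      using T(1,2) by (intro exI[of _ T]) simp
  qed
  then show ?thesis
    unfolding constant_on_def by simp
qed

section \<open>Forms and areas under a finite cover\<close>

context
  fixes X :: "'a::{t2_space,second_countable_topology} surface_with_form"
    and Y :: "'b::{t2_space,second_countable_topology} surface_with_form"
    and p :: "'b \<Rightarrow> 'a"
  assumes X: "translation_surface X" and Y: "translation_surface Y"
    and cover: "finite_translation_cover Y p X"
begin

lemma cover_covering_space: "covering_space UNIV p UNIV"
  using cover unfolding finite_translation_cover_def by simp

lemma cover_open_vimage: "open A \<Longrightarrow> open (p -` A)"
  using covering_space_imp_continuous[OF cover_covering_space] by (rule open_vimage[rotated])

lemma cover_measurable: "p \<in> borel_measurable borel"
  using covering_space_imp_continuous[OF cover_covering_space] by (rule borel_measurable_continuous_onI)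

lemma cover_sheet: "\<exists>u T q. open u \<and> y \<in> u \<and> open T \<and> homeomorphism u T p q"
proof -
  obtain T v where T: "p y \<in> T" "open T" "\<Union>v = p -` T" "\<And>u. u \<in> v \<Longrightarrow> open u"
    "\<And>u. u \<in> v \<Longrightarrow> \<exists>q. homeomorphism u T p q"
    using evenly_covered[OF cover_covering_space] by metis
  then have "y \<in> \<Union>v"
    by auto
  then obtain u where u: "u \<in> v" "y \<in> u"
    by blast
  then obtain q where "homeomorphism u T p q"
    using T(5) by blast
  then show ?thesis
    using u T(2,4) by (intro exI[of _ u] exI[of _ T] exI[of _ q]) simp
qed

text \<open>On a sheet \<open>p\<close> is injective, hence so is its coordinate expression, and
  injective holomorphic maps have nonzero derivative. The cover is therefore unramified and neither
  creates nor removes zeros of the form.\<close>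

lemma cover_in_charts:
  assumes c: "c \<in> atlas Y" "y \<in> fst c" and d: "d \<in> atlas X" "p y \<in> fst d"
  shows "(in_charts c d p has_field_derivative deriv (in_charts c d p) (snd c y)) (at (snd c y))"
    and "deriv (in_charts c d p) (snd c y) \<noteq> 0"
    and "coeff Y c (snd c y) = coeff X d (snd d (p y)) * deriv (in_charts c d p) (snd c y)"
proof -
  let ?h = "in_charts c d p" and ?N = "fst c \<inter> p -` fst d"
  have chc: "is_chart (fst c, snd c)" and chd: "is_chart (fst d, snd d)"
    using atlas_chart[OF Y c(1)] atlas_chart[OF X d(1)] .
  have hol: "?h holomorphic_on snd c ` ?N"
    and co: "\<And>y. y \<in> ?N \<Longrightarrow> coeff Y c (snd c y) = coeff X d (snd d (p y)) * deriv ?h (snd c y)"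
    using cover c(1) d(1) unfolding finite_translation_cover_def by auto
  have y: "y \<in> ?N"
    using c(2) d(2) by simp
  obtain u T q where u: "open u" "y \<in> u" "homeomorphism u T p q"
    using cover_sheet by blast
  have inj_u: "inj_on p u"
    using u(3) unfolding homeomorphism_def by (auto intro: inj_on_inverseI)
  have opN: "open ?N"
    using is_chart_open(1)[OF chc] cover_open_vimage[OF is_chart_open(1)[OF chd]] by auto
  have opA: "open (snd c ` (?N \<inter> u))"
    by (rule is_chart_open_image[OF chc]) (use opN u(1) in auto)
  have "inj_on ?h (snd c ` (?N \<inter> u))"
  proof (rule inj_onI, elim imageE)
    fix z w a b assume ab: "?h z = ?h w" "z = snd c a" "a \<in> ?N \<inter> u" "w = snd c b" "b \<in> ?N \<inter> u"
    then have "snd d (p a) = snd d (p b)"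
      using atlas_inv_into[OF Y c(1)] by (simp add: in_charts_eq)
    then have "p a = p b"
      using is_chart_inj[OF chd] ab by (auto dest: inj_onD)
    then show "z = w"
      using inj_u ab by (auto dest: inj_onD)
  qed
  moreover have "?h holomorphic_on snd c ` (?N \<inter> u)"
    using hol by (rule holomorphic_on_subset) auto
  ultimately show "deriv ?h (snd c y) \<noteq> 0"
    using opA y u(2) by (intro holomorphic_injective_imp_regular) auto
  show "(?h has_field_derivative deriv ?h (snd c y)) (at (snd c y))"
    by (rule holomorphic_derivI[OF hol]) (use is_chart_open_image[OF chc opN] y in auto)
  show "coeff Y c (snd c y) = coeff X d (snd d (p y)) * deriv ?h (snd c y)"
    by (rule co[OF y])
qed

lemma zeros_cover: "y \<in> zeros Y \<longleftrightarrow> p y \<in> zeros X"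
proof -
  obtain c d where c: "c \<in> atlas Y" "y \<in> fst c" and d: "d \<in> atlas X" "p y \<in> fst d"
    using atlas_covers[OF Y] atlas_covers[OF X] by metis
  show ?thesis
    using cover_in_charts(2,3)[OF c d] zeros_iff[OF Y c] zeros_iff[OF X d] by simp
qed

text \<open>A translation chart \<open>\<psi>\<close> downstairs, composed with \<open>p\<close> on
  a sheet, is a translation chart upstairs. Between these two charts \<open>p\<close> is the
  identity, whence \<open>k = 0\<close>.\<close>

lemma local_translation_cover:
  assumes y: "y \<notin> zeros Y"
  shows "local_translation Y X p y"
proof -
  obtain U \<psi> where U: "translation_chart X (U, \<psi>)" "p y \<in> U"
    using translation_chart_exists[OF X] y zeros_cover by blast
  have c: "is_chart (U, \<psi>)"
    using translation_chart_chart[OF U(1)] .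
  obtain u T q where u: "open u" "y \<in> u" "open T" "homeomorphism u T p q"
    using cover_sheet by blast
  define V where "V = u \<inter> p -` U"
  have pu: "p ` u = T"
    using u(4) unfolding homeomorphism_def by simp
  then have pV: "p ` V = T \<inter> U"
    unfolding V_def by blast
  have opV: "open V"
    unfolding V_def using u(1) cover_open_vimage[OF is_chart_open(1)[OF c]] by (rule open_Int)
  have opTU: "open (T \<inter> U)"
    using u(3) is_chart_open(1)[OF c] by (rule open_Int)
  have "is_chart (V, \<psi> \<circ> p)"
    unfolding is_chart_def
  proof (simp only: prod.case, intro conjI exI)
    have img: "(\<psi> \<circ> p) ` V = \<psi> ` (T \<inter> U)"
      by (simp only: image_comp[symmetric] pV)
    show "open V"
      by (rule opV)
    show "open ((\<psi> \<circ> p) ` V)"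
      unfolding img using is_chart_open_image[OF c opTU] by simp
    have "homeomorphism V (T \<inter> U) p q"
      by (rule homeomorphism_of_subsets[OF u(4)]) (use pV in \<open>auto simp: V_def\<close>)
    moreover have "homeomorphism (T \<inter> U) (\<psi> ` (T \<inter> U)) \<psi> (inv_into U \<psi>)"
      by (rule homeomorphism_of_subsets[OF is_chart_homeomorphism[OF c]]) auto
    ultimately show "homeomorphism V ((\<psi> \<circ> p) ` V) (\<psi> \<circ> p) (q \<circ> inv_into U \<psi>)"
      unfolding img by (rule homeomorphism_compose)
  qed
  moreover have "V \<inter> zeros Y = {}"
    using U(1) zeros_cover unfolding translation_chart_def V_def by auto
  moreover have "(in_charts c' (V, \<psi> \<circ> p) id has_field_derivative coeff Y c' (snd c' a)) (at (snd c' a))"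
    if c': "c' \<in> atlas Y" and a: "a \<in> fst c' \<inter> V" for c' a
  proof -
    obtain d where d: "d \<in> atlas X" "p a \<in> fst d"
      using atlas_covers[OF X] by blast
    let ?h = "in_charts c' d p" and ?g = "in_charts d (U, \<psi>) id"
    have ac: "a \<in> fst c'" "p a \<in> U"
      using a by (auto simp: V_def)
    have chc: "is_chart (fst c', snd c')"
      using atlas_chart[OF Y c'] .
    have hy: "?h (snd c' a) = snd d (p a)"
      using atlas_inv_into[OF Y c' ac(1)] by (simp add: in_charts_eq)
    have "(?g has_field_derivative coeff X d (snd d (p a))) (at (?h (snd c' a)))"
      unfolding hy using U(1) d ac(2) unfolding translation_chart_def by simp
    from DERIV_chain[OF this cover_in_charts(1)[OF c' ac(1) d]]
    have *: "(?g \<circ> ?h has_field_derivative coeff Y c' (snd c' a)) (at (snd c' a))"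
      using cover_in_charts(3)[OF c' ac(1) d] by simp
    \<comment> \<open>The two coordinate expressions need only agree where \<open>p\<close> lands in
      the domain of \<open>d\<close>, because \<open>inv_into\<close> is arbitrary elsewhere. The
      derivative is transferred on the open image of \<open>?N\<close>.\<close>
    let ?N = "fst c' \<inter> p -` fst d"
    have "open ?N"
      using is_chart_open(1)[OF chc] cover_open_vimage[OF is_chart_open(1)[OF atlas_chart[OF X d(1)]]]
      by (rule open_Int)
    then have "open (snd c' ` ?N)"
      by (rule is_chart_open_image[OF chc]) simp
    moreover have "(?g \<circ> ?h) z = in_charts c' (V, \<psi> \<circ> p) id z" if z: "z \<in> snd c' ` ?N" for z
    proof -
      obtain b where b: "b \<in> ?N" "z = snd c' b"
        using z by blast
      then show ?thesis
        using atlas_inv_into[OF Y c', of b] atlas_inv_into[OF X d(1), of "p b"]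
        by (simp add: in_charts_eq)
    qed
    ultimately show ?thesis
      using * ac(1) d(2) by (intro has_field_derivative_transform_within_open[OF *]) auto
  qed
  ultimately have "translation_chart Y (V, \<psi> \<circ> p)"
    unfolding translation_chart_def by simp
  then show ?thesis
    by (rule local_translationI[OF _ U(1) opV, where k = 0]) (use U(2) u(2) in \<open>auto simp: V_def\<close>)
qed

text \<open>Over an evenly covered set the preimage of \<open>B\<close> consists of \<open>n\<close>
  disjoint copies of \<open>B\<close>, one on each sheet and each of the same area. Surjectivity of
  \<open>p\<close> gives \<open>n > 0\<close>, which later permits cancelling
  \<open>n\<close>.\<close>

lemma distr_area_measure_cover:
  "\<exists>n > 0. distr (area_measure Y) borel p = scale_measure (of_nat n) (area_measure X)"
proof -
  obtain n where n: "\<And>x. card (p -` {x}) = n"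
    using card_fibre_constant[OF cover_covering_space connected_surface[OF X]] by blast
  have fin: "finite (p -` {x})" for x
    using cover unfolding finite_translation_cover_def by simp
  have "p -` {x} \<noteq> {}" for x
    using covering_space_imp_surjective[OF cover_covering_space] by (metis empty_iff rangeE UNIV_I vimage_singleton_eq)
  then have "n > 0"
    using n fin by (metis card_gt_0_iff)
  have p_meas: "p \<in> measurable (area_measure Y) borel"
    using cover_measurable sets_area_measure[OF Y] by (simp cong: measurable_cong_sets)
  have distr: "emeasure (distr (area_measure Y) borel p) A = emeasure (area_measure Y) (p -` A)"
    if "A \<in> sets borel" for A
    using emeasure_distr[OF p_meas that] by (simp add: space_area_measure[OF Y])
  have vimage: "p -` A \<in> sets borel" if "A \<in> sets borel" for A
    using measurable_sets[OF cover_measurable that] by simp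
  have "distr (area_measure Y) borel p = scale_measure (of_nat n) (area_measure X)"
  proof (rule measure_eqI)
    show sets_eq: "sets (distr (area_measure Y) borel p) = sets (scale_measure (of_nat n) (area_measure X))"
      by (simp add: sets_area_measure[OF X])
    fix A assume "A \<in> sets (distr (area_measure Y) borel p)"
    then have A: "A \<in> sets borel"
      by simp
    \<comment> \<open>Off the zeros \<open>p\<close> is a local translation. The zeros are null for
      both measures, since their preimage is \<open>zeros Y\<close>.\<close>
    let ?A = "A - zeros X"
    have A': "?A \<in> sets borel"
      using A zeros_borel[OF X] by simp
    have "\<exists>T. open T \<and> x \<in> T \<and> (\<forall>B\<in>sets borel. B \<subseteq> T \<inter> ?A \<longrightarrow>
      emeasure (distr (area_measure Y) borel p) B = emeasure (scale_measure (of_nat n) (area_measure X)) B)" for x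
    proof -
      obtain T v where T: "x \<in> T" "open T" "\<Union>v = p -` T" "\<And>u. u \<in> v \<Longrightarrow> open u" "pairwise disjnt v"
        "\<And>u. u \<in> v \<Longrightarrow> \<exists>q. homeomorphism u T p q"
        using evenly_covered[OF cover_covering_space] by metis
      have img: "p ` u = T" and inj: "inj_on p u" if "u \<in> v" for u
        using T(6)[OF that] unfolding homeomorphism_def by (auto intro: inj_on_inverseI)
      have card_v: "card v = n" and fin_v: "finite v"
      proof -
        have "bij_betw (\<lambda>u. inv_into u p x) v (p -` {x})"
          using bij_betw_sheets_fibre[OF T(3,5,6,1)] .
        then show "card v = n" "finite v"
          using bij_betw_same_card n bij_betw_finite fin by metis+
      qed
      have "emeasure (area_measure Y) (p -` B) = of_nat n * emeasure (area_measure X) B"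
        if B: "B \<in> sets borel" "B \<subseteq> T \<inter> ?A" for B
      proof -
        have sheet: "emeasure (area_measure Y) (u \<inter> p -` B) = emeasure (area_measure X) B" if u: "u \<in> v" for u
        proof -
          have "p ` (u \<inter> p -` B) = B"
            using img[OF u] B(2) by blast
          moreover have "emeasure (area_measure X) (p ` (u \<inter> p -` B)) = emeasure (area_measure Y) (u \<inter> p -` B)"
          proof (rule local_translation_area[OF Y X])
            show "u \<inter> p -` B \<in> sets borel"
              using T(4)[OF u] vimage[OF B(1)] by simp
            show "inj_on p (u \<inter> p -` B)"
              using inj[OF u] by (rule inj_on_subset) simp
            show "local_translation Y X p y" if "y \<in> u \<inter> p -` B" for y
              using that B(2) zeros_cover by (intro local_translation_cover) auto
          qed
          ultimately show ?thesis
            by simp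
        qed
        have "p -` B = (\<Union>u\<in>v. u \<inter> p -` B)"
          using T(3) B(2) by auto
        moreover have "emeasure (area_measure Y) (\<Union>u\<in>v. u \<inter> p -` B) = (\<Sum>u\<in>v. emeasure (area_measure Y) (u \<inter> p -` B))"
        proof (rule sum_emeasure[symmetric])
          show "(\<lambda>u. u \<inter> p -` B) ` v \<subseteq> sets (area_measure Y)"
            using T(4) vimage[OF B(1)] by (auto simp: sets_area_measure[OF Y])
          show "disjoint_family_on (\<lambda>u. u \<inter> p -` B) v"
            using T(5) unfolding disjoint_family_on_def pairwise_def disjnt_def by auto
        qed (rule fin_v)
        ultimately show ?thesis
          using sheet card_v by simp
      qed
      then show ?thesis
        using T(1,2) distr by (intro exI[of _ T]) simp
    qed
    then have "emeasure (distr (area_measure Y) borel p) ?A = emeasure (scale_measure (of_nat n) (area_measure X)) ?A"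
      using A' by (intro emeasure_eq_if_locally_eq) (simp_all add: sets_area_measure[OF X])
    moreover have "emeasure (scale_measure (of_nat n) (area_measure X)) ?A = emeasure (scale_measure (of_nat n) (area_measure X)) A"
      using A zeros_borel[OF X] emeasure_area_zeros[OF X]
      by (intro emeasure_Diff_null_set) (auto simp: null_sets_def sets_area_measure[OF X])
    moreover have "emeasure (distr (area_measure Y) borel p) ?A = emeasure (distr (area_measure Y) borel p) A"
    proof (rule emeasure_Diff_null_set)
      have "p -` zeros X = zeros Y"
        using zeros_cover by auto
      then show "zeros X \<in> null_sets (distr (area_measure Y) borel p)"
        using distr[OF zeros_borel[OF X]] emeasure_area_zeros[OF Y] zeros_borel[OF X] by (simp add: null_sets_def)
    qed (use A in simp)
    ultimately show "emeasure (distr (area_measure Y) borel p) A = emeasure (scale_measure (of_nat n) (area_measure X)) A"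
      by simp
  qed
  then show ?thesis
    using \<open>n > 0\<close> by blast
qed

end

section \<open>Uniqueness\<close>

lemma emeasure_lebesgue_prob_UNIV:
  fixes X :: "'a::{t2_space,second_countable_topology} surface_with_form"
  assumes "translation_surface X" "finite_area X"
  shows "emeasure (lebesgue_prob X) UNIV = 1"
proof -
  let ?a = "emeasure (area_measure X) UNIV"
  have "?a / ?a = 1"
    using emeasure_area_nonzero[OF assms(1)] assms(2) unfolding finite_area_def by simp
  then show ?thesis
    by (simp add: lebesgue_prob_def divide_ennreal_def mult.commute)
qed

text \<open>Finite area makes the scaling factor nonzero: an inverse in \<open>ennreal\<close>
  vanishes only at infinity.\<close>

lemma null_sets_lebesgue_prob:
  assumes "finite_area X"
  shows "null_sets (lebesgue_prob X) = null_sets (area_measure X)"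
  using assms unfolding finite_area_def by (auto simp: null_sets_def lebesgue_prob_def)

text \<open>Cancel the measure of \<open>E \<inter> B\<close>, which is finite.\<close>

lemma emeasure_symmetric_difference:
  assumes E: "E \<in> sets M" and B: "B \<in> sets M"
    and eq: "emeasure M E = emeasure M B" and fin: "emeasure M B \<noteq> \<infinity>"
  shows "emeasure M (E - B) = emeasure M (B - E)"
proof -
  have "emeasure M (E \<inter> B) + emeasure M (E - B) = emeasure M E"
    using E B by (subst plus_emeasure) (auto simp: Int_Diff_Un)
  also have "\<dots> = emeasure M (E \<inter> B) + emeasure M (B - E)"
    unfolding eq using E B by (subst plus_emeasure) (auto intro!: arg_cong[where f = "emeasure M"])
  finally have "emeasure M (E \<inter> B) + emeasure M (E - B) = emeasure M (E \<inter> B) + emeasure M (B - E)" .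
  moreover have "emeasure M (E \<inter> B) \<le> emeasure M B"
    using B by (intro emeasure_mono) auto
  then have "emeasure M (E \<inter> B) \<noteq> \<infinity>"
    using fin by (auto simp: top_unique)
  ultimately show ?thesis
    by (simp add: ennreal_add_left_cancel)
qed

text \<open>
  The set \<open>B = {f < 1}\<close>, for \<open>f\<close> the density of \<open>\<nu>\<close>, is invariant: if \<open>E\<close> is its preimage under
  a time \<open>t\<close> map, then \<open>E - B\<close> and \<open>B - E\<close> have the same Lebesgue measure and the same \<open>\<nu>\<close>-measure,
  but \<open>f \<ge> 1\<close> on the former and \<open>f < 1\<close> on the latter.
\<close>

lemma flow_invariant_absolutely_continuous_unique:
  fixes X :: "'a::{t2_space,second_countable_topology} surface_with_form"
  assumes X: "translation_surface X" and prob: "emeasure (lebesgue_prob X) UNIV = 1"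
    and ae: "flow_defined_ae X" and erg: "flow_ergodic X"
    and \<nu>: "sets \<nu> = sets borel" "flow_invariant X \<nu>" "emeasure \<nu> UNIV = 1"
    and ac: "absolutely_continuous (lebesgue_prob X) \<nu>"
  shows "\<nu> = lebesgue_prob X"
proof -
  let ?L = "lebesgue_prob X"
  have setsL [measurable_cong]: "sets ?L = sets borel" and spaceL: "space ?L = UNIV"
    using sets_lebesgue_prob[OF X] space_lebesgue_prob[OF X] .
  interpret finite_measure ?L
    by (rule finite_measureI) (simp add: spaceL prob)
  obtain f where f [measurable]: "f \<in> borel_measurable ?L" and f\<nu>: "density ?L f = \<nu>"
    using Radon_Nikodym[OF ac] \<nu>(1) setsL by auto
  have \<nu>_eq: "emeasure \<nu> A = (\<integral>\<^sup>+x. f x * indicator A x \<partial>?L)" if "A \<in> sets borel" for A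
    unfolding f\<nu>[symmetric] using that by (intro emeasure_density) (simp_all add: setsL)
  have L_le1: "emeasure ?L A \<le> 1" if "A \<in> sets borel" for A
    using emeasure_mono[of A UNIV ?L] prob by (simp add: setsL)
  have \<nu>_le1: "emeasure \<nu> A \<le> 1" if "A \<in> sets borel" for A
    using emeasure_mono[of A UNIV \<nu>] \<nu>(1,3) by simp
  define B where "B = {x \<in> space ?L. f x < 1}"
  have B: "B \<in> sets borel"
    unfolding B_def setsL[symmetric] by measurable
  have inv: "AE x in ?L. x \<in> flow_preimage X t B \<longleftrightarrow> x \<in> B" for t
  proof -
    let ?E = "flow_preimage X t B"
    have E: "?E \<in> sets borel"
      using flow_preimage_borel[OF X B] .
    have D: "?E - B \<in> sets borel" "B - ?E \<in> sets borel"
      using E B by auto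
    have L_diff: "emeasure ?L (?E - B) = emeasure ?L (B - ?E)"
      by (rule emeasure_symmetric_difference)
        (use E B flow_invariant_lebesgue_prob[OF X ae] L_le1[OF B] in \<open>auto simp: setsL flow_invariant_def top_unique\<close>)
    have \<nu>_diff: "emeasure \<nu> (?E - B) = emeasure \<nu> (B - ?E)"
      by (rule emeasure_symmetric_difference)
        (use E B \<nu>(1,2) \<nu>_le1[OF B] in \<open>auto simp: flow_invariant_def top_unique\<close>)
    have ind: "(\<integral>\<^sup>+x. indicator A x \<partial>?L) = emeasure ?L A" if "A \<in> sets borel" for A
      using that by (simp add: setsL)
    have "emeasure ?L (?E - B) \<le> emeasure \<nu> (?E - B)"
      unfolding \<nu>_eq[OF D(1)] ind[OF D(1), symmetric]
      by (rule nn_integral_mono) (auto simp: B_def spaceL indicator_def not_less)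
    then have le: "emeasure ?L (B - ?E) \<le> emeasure \<nu> (B - ?E)"
      using L_diff \<nu>_diff by simp
    \<comment> \<open>On \<open>B\<close> the density is below 1, so the right side never exceeds
      the left. If it were strictly smaller on a set of positive measure, the integrals would
      contradict \<open>le\<close>.\<close>
    have "AE x in ?L. indicator (B - ?E) x \<le> f x * indicator (B - ?E) x"
    proof (rule ccontr)
      assume neg: "\<not> (AE x in ?L. indicator (B - ?E) x \<le> f x * indicator (B - ?E) x)"
      have "emeasure \<nu> (B - ?E) < emeasure ?L (B - ?E)"
        unfolding \<nu>_eq[OF D(2)] ind[OF D(2), symmetric]
      proof (rule nn_integral_less[OF _ _ _ _ neg])
        show "(\<lambda>x. f x * indicator (B - ?E) x) \<in> borel_measurable ?L"
          "indicator (B - ?E) \<in> borel_measurable ?L"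
          using D(2) f by (auto simp: setsL)
        show "(\<integral>\<^sup>+x. f x * indicator (B - ?E) x \<partial>?L) \<noteq> \<infinity>"
          using \<nu>_eq[OF D(2)] \<nu>_le1[OF D(2)] by (auto simp: top_unique)
        show "AE x in ?L. f x * indicator (B - ?E) x \<le> indicator (B - ?E) x"
          by (rule AE_I2) (auto simp: B_def indicator_def)
      qed
      then show False
        using le by simp
    qed
    then have 1: "AE x in ?L. x \<notin> B - ?E"
    proof eventually_elim
      fix x assume *: "indicator (B - ?E) x \<le> f x * indicator (B - ?E) x"
      show "x \<notin> B - ?E"
      proof
        assume x: "x \<in> B - ?E"
        have "1 \<le> f x"
          using * by (simp only: indicator_simps(1)[OF x] mult_1_right)
        moreover have "f x < 1"
          using x by (simp add: B_def)
        ultimately show False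
          by (simp add: leD)
      qed
    qed
    then have "emeasure ?L (B - ?E) = 0"
      using D(2) by (subst (asm) AE_iff_measurable[of "B - ?E"]) (auto simp: setsL spaceL)
    \<comment> \<open>The two differences have equal Lebesgue measure, so the second is null as soon
      as the first is.\<close>
    then have "AE x in ?L. x \<notin> ?E - B"
      using L_diff D(1) by (intro AE_not_in) (auto simp: null_sets_def setsL)
    with 1 show ?thesis
      by eventually_elim auto
  qed
  have ones: "(\<integral>\<^sup>+x. 1 \<partial>?L) = 1" "(\<integral>\<^sup>+x. f x \<partial>?L) = 1"
    using prob \<nu>_eq[of UNIV] \<nu>(3) by (simp_all add: spaceL)
  have "(AE x in ?L. x \<in> B) \<or> (AE x in ?L. x \<notin> B)"
    using erg B inv unfolding flow_ergodic_def by blast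
  \<comment> \<open>The density has integral 1 over a probability space. If \<open>f < 1\<close>
    almost everywhere its integral would be too small; if \<open>f \<ge> 1\<close> almost
    everywhere, any excess would make it too large.\<close>
  then have "AE x in ?L. f x = 1"
  proof
    assume "AE x in ?L. x \<in> B"
    then have less: "AE x in ?L. f x < 1"
      by eventually_elim (simp add: B_def)
    have "(\<integral>\<^sup>+x. f x \<partial>?L) < (\<integral>\<^sup>+x. 1 \<partial>?L)"
    proof (rule nn_integral_less)
      show "AE x in ?L. f x \<le> 1"
        using less by eventually_elim simp
      show "\<not> (AE x in ?L. 1 \<le> f x)"
      proof
        assume "AE x in ?L. 1 \<le> f x"
        with less have "AE x in ?L. False"
          by eventually_elim auto
        then show False
          using AE_iff_measurable[of UNIV ?L "\<lambda>_. False"] prob by (simp add: spaceL setsL)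
      qed
    qed (use ones in auto)
    then show ?thesis
      using ones by simp
  next
    assume "AE x in ?L. x \<notin> B"
    then have ge: "AE x in ?L. 1 \<le> f x"
      by eventually_elim (auto simp: B_def spaceL not_less)
    have "AE x in ?L. f x \<le> 1"
    proof (rule ccontr)
      assume "\<not> (AE x in ?L. f x \<le> 1)"
      then have "(\<integral>\<^sup>+x. 1 \<partial>?L) < (\<integral>\<^sup>+x. f x \<partial>?L)"
        using ge ones by (intro nn_integral_less) auto
      then show False
        using ones by simp
    qed
    with ge show ?thesis
      by eventually_elim auto
  qed
  then have "density ?L f = density ?L (\<lambda>_. 1)"
    by (intro density_cong) auto
  then show ?thesis
    using f\<nu> by (simp add: density_1)
qed

section \<open>Measures on the cover that project to Lebesgue measure\<close>

context
  fixes X :: "'a::{t2_space,second_countable_topology} surface_with_form"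
    and Y :: "'b::{t2_space,second_countable_topology} surface_with_form"
    and p :: "'b \<Rightarrow> 'a"
  assumes X: "translation_surface X" and Y: "translation_surface Y"
    and cover: "finite_translation_cover Y p X" and finX: "finite_area X"
begin

text \<open>The push-forward carries the factor \<open>n\<close>, and the total area of the cover is
  \<open>n\<close> times that of the base, so normalization cancels the degree.\<close>

lemma finite_area_cover: "finite_area Y"
  and distr_lebesgue_prob_cover: "distr (lebesgue_prob Y) borel p = lebesgue_prob X"
proof -
  obtain n :: nat where n: "n > 0" "distr (area_measure Y) borel p = scale_measure (of_nat n) (area_measure X)"
    using distr_area_measure_cover[OF X Y cover] by blast
  have p_meas: "p \<in> measurable M borel" if "sets M = sets borel" for M :: "'b measure"
    using cover_measurable[OF X Y cover] that by (simp cong: measurable_cong_sets)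
  have area: "emeasure (area_measure Y) (p -` A) = of_nat n * emeasure (area_measure X) A" if "A \<in> sets borel" for A
    using emeasure_distr[OF p_meas[OF sets_area_measure[OF Y]] that] n(2)
    by (simp add: space_area_measure[OF Y])
  let ?a = "emeasure (area_measure X) UNIV" and ?b = "emeasure (area_measure Y) UNIV"
  have b: "?b = of_nat n * ?a"
    using area[of UNIV] by simp
  have a: "?a < \<infinity>"
    using finX unfolding finite_area_def by simp
  show "finite_area Y"
    unfolding finite_area_def b using a by (simp add: ennreal_mult_less_top of_nat_less_top)
  have "inverse ?b * of_nat n = inverse ?a"
  proof -
    have "inverse ?b * of_nat n = inverse ?a * (of_nat n / of_nat n)"
      unfolding b using a by (subst ennreal_inverse_mult) (auto simp: divide_ennreal_def mult_ac of_nat_less_top)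
    then show ?thesis
      using n(1) by (simp add: of_nat_less_top)
  qed
  then show "distr (lebesgue_prob Y) borel p = lebesgue_prob X"
    using emeasure_distr[OF p_meas[OF sets_lebesgue_prob[OF Y]]] area
    by (intro measure_eqI)
      (simp_all add: sets_lebesgue_prob[OF X] space_lebesgue_prob[OF Y],
       simp add: lebesgue_prob_def mult.assoc[symmetric])
qed

lemma absolutely_continuous_if_distr_cover:
  assumes \<nu>: "sets \<nu> = sets borel" "distr \<nu> borel p = lebesgue_prob X"
  shows "absolutely_continuous (lebesgue_prob Y) \<nu>"
  unfolding absolutely_continuous_def
proof
  fix N assume "N \<in> null_sets (lebesgue_prob Y)"
  then have N: "N \<in> sets borel" "emeasure (area_measure Y) N = 0"
    unfolding null_sets_lebesgue_prob[OF finite_area_cover] by (auto simp: null_sets_def sets_area_measure[OF Y])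
  let ?N = "N - zeros Y"
  \<comment> \<open>The part of \<open>N\<close> inside \<open>zeros Y\<close> is out of reach of
    the local translation argument, but \<open>p\<close> sends it into the null set
    \<open>zeros X\<close>.\<close>
  let ?A = "p ` ?N \<union> zeros X"
  have N': "?N \<in> sets borel"
    using N(1) zeros_borel[OF Y] by auto
  have "emeasure (area_measure Y) ?N = 0"
    using emeasure_mono[of ?N N "area_measure Y"] N by (simp add: sets_area_measure[OF Y])
  then have "p ` ?N \<in> null_sets (area_measure X)"
    using local_translation_null_image[OF Y X N'] local_translation_borel_image[OF Y X N']
      local_translation_cover[OF X Y cover]
    by (auto simp: null_sets_def sets_area_measure[OF X])
  moreover have "zeros X \<in> null_sets (area_measure X)"
    using emeasure_area_zeros[OF X] zeros_borel[OF X] by (simp add: null_sets_def sets_area_measure[OF X])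
  ultimately have A: "?A \<in> null_sets (lebesgue_prob X)"
    unfolding null_sets_lebesgue_prob[OF finX] by (rule null_sets.Un)
  then have A_borel: "?A \<in> sets borel"
    using null_setsD2 sets_lebesgue_prob[OF X] by blast
  have p_meas: "p \<in> measurable \<nu> borel"
    using cover_measurable[OF X Y cover] \<nu>(1) by (simp cong: measurable_cong_sets)
  have space: "space \<nu> = UNIV"
    using sets_eq_imp_space_eq[OF \<nu>(1)] by simp
  have "emeasure \<nu> (p -` ?A) = emeasure (lebesgue_prob X) ?A"
    using emeasure_distr[OF p_meas A_borel] \<nu>(2) space by simp
  also have "\<dots> = 0"
    using A by (rule null_setsD1)
  finally have "emeasure \<nu> (p -` ?A) = 0" .
  moreover have "N \<subseteq> p -` ?A"
    using zeros_cover[OF X Y cover] by auto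
  moreover have "p -` ?A \<in> sets \<nu>"
    using measurable_sets[OF p_meas A_borel] space by simp
  ultimately show "N \<in> null_sets \<nu>"
    using null_sets_subset[of "p -` ?A" \<nu> N] N(1) \<nu>(1) by (simp add: null_sets_def)
qed

end

theorem proposition2:
  fixes S :: "'a::{t2_space,second_countable_topology} surface_with_form"
    and S' :: "'b::{t2_space,second_countable_topology} surface_with_form"
    and p :: "'b \<Rightarrow> 'a"
  assumes "translation_surface S" and "finite_area S"
    and "infinite_topological_type TYPE('a)"
    and "translation_surface S'" and "finite_translation_cover S' p S"
    and "flow_defined_ae S" and "flow_ergodic S"
    and "flow_defined_ae S'" and "flow_ergodic S'"
  shows "{\<nu> :: 'b measure. sets \<nu> = sets borel \<and> flow_invariant S' \<nu> \<and>
            distr \<nu> borel p = lebesgue_prob S} = {lebesgue_prob S'}"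
proof (intro equalityI subsetI)
  fix \<nu> :: "'b measure"
  assume "\<nu> \<in> {\<nu>. sets \<nu> = sets borel \<and> flow_invariant S' \<nu> \<and> distr \<nu> borel p = lebesgue_prob S}"
  then have \<nu>: "sets \<nu> = sets borel" "flow_invariant S' \<nu>" "distr \<nu> borel p = lebesgue_prob S"
    by auto
  have p_meas: "p \<in> measurable \<nu> borel"
    using cover_measurable[OF assms(1,4,5)] \<nu>(1) by (simp cong: measurable_cong_sets)
  \<comment> \<open>Projection preserves total mass, so a measure of which only the push-forward is
    prescribed is already a probability measure.\<close>
  have "emeasure \<nu> UNIV = emeasure (lebesgue_prob S) UNIV"
    using emeasure_distr[OF p_meas, of UNIV] \<nu>(3) sets_eq_imp_space_eq[OF \<nu>(1)] by simp
  then have "emeasure \<nu> UNIV = 1"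
    using emeasure_lebesgue_prob_UNIV[OF assms(1,2)] by simp
  then have "\<nu> = lebesgue_prob S'"
    using emeasure_lebesgue_prob_UNIV[OF assms(4) finite_area_cover[OF assms(1,4,5,2)]]
      absolutely_continuous_if_distr_cover[OF assms(1,4,5,2) \<nu>(1,3)] \<nu>(1,2) assms(4,8,9)
    by (intro flow_invariant_absolutely_continuous_unique)
  then show "\<nu> \<in> {lebesgue_prob S'}"
    by simp
next
  \<comment> \<open>The equality of sets also claims existence: Lebesgue measure on the cover is
    itself invariant and projects correctly.\<close>
  fix \<nu> assume "\<nu> \<in> {lebesgue_prob S'}"
  then show "\<nu> \<in> {\<nu>. sets \<nu> = sets borel \<and> flow_invariant S' \<nu> \<and> distr \<nu> borel p = lebesgue_prob S}"
    using sets_lebesgue_prob[OF assms(4)] flow_invariant_lebesgue_prob[OF assms(4,8)]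
      distr_lebesgue_prob_cover[OF assms(1,4,5,2)] by simp
qed

end
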